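(* Let $n\ge2$ be an integer, $p>1$, and let $f:\mathbb{R}_+\to\mathbb{R}_-$ be continuous. Suppose one of the following conditions holds: (1) $p<n$ and there exists $q\in(p-1,p_*-1)$, where $p_*=\frac{(n-1)p}{n-p}$, such that $\int_1^{+\infty}[-f(v)]^{-\frac1q}\,\mathrm{d}v<\infty$; (2) $p\ge n$ and there exists $q>p-1$ such that $\int_1^{+\infty}[-f(v)]^{-\frac1q}\,\mathrm{d}v<\infty$. Then the anisotropic equation $-\Delta_p^H u=f(u)$ in $\mathbb{R}^n$ admits no positive subsolution.
   Context: $\mathbb{R}_+=(0,\infty)$, $\mathbb{R}_-=(-\infty,0)$. $H\in C^2(\mathbb{R}^n\setminus\{0\})\cap C(\mathbb{R}^n)$ is a fixed positively homogeneous function of degree one ($H(t\xi)=tH(\xi)$ for $t>0$, $H(0)=0$), positive on $\mathbb{S}^{n-1}$ (not assumed even), and uniformly convex, i.e. the unit ball $\{\xi: H(\xi)<1\}$ is uniformly convex (its boundary has principal curvatures bounded below by a positive constant). Set $a(\xi)=\frac1p\nabla_\xi H^p(\xi)$ (with $a(0)=0$) and $\Delta_p^H u=\operatorname{div}(a(\nabla u))$. A subsolution of $-\Delta_p^H u=f(u)$ in $\mathbb{R}^n$ is a function $u\in W^{1,p}_{\mathrm{loc}}(\mathbb{R}^n)\cap C(\mathbb{R}^n)$ such that $\int_{\mathbb{R}^n}a(\nabla u)\cdot\nabla\varphi\le\int_{\mathbb{R}^n}f(u)\varphi$ for all $\varphi\in C_c^\infty(\mathbb{R}^n)$ with $\varphi\ge0$.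 It is positive if $u>0$ in $\mathbb{R}^n$. *)

theory Defs
  imports "HOL-Analysis.Analysis"
begin

definition grad :: "('a::euclidean_space \<Rightarrow> real) \<Rightarrow> 'a \<Rightarrow> 'a" where
  "grad g x = (\<Sum>b\<in>Basis. frechet_derivative g (at x) b *\<^sub>R b)"

text \<open>The class \<open>C\<^sup>k\<close> on an open set \<open>S\<close>, through iterated partial derivatives.\<close>

fun Ck_on :: "nat \<Rightarrow> 'a::euclidean_space set \<Rightarrow> ('a \<Rightarrow> real) \<Rightarrow> bool" where
  "Ck_on 0 S g \<longleftrightarrow> continuous_on S g"
| "Ck_on (Suc k) S g \<longleftrightarrow>
     (\<forall>x\<in>S. g differentiable (at x)) \<and>
     (\<forall>b\<in>Basis. Ck_on k S (\<lambda>x. frechet_derivative g (at x) b))"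

definition test_functions :: "('a::euclidean_space \<Rightarrow> real) set" where
  "test_functions = {\<phi>. (\<forall>k. Ck_on k UNIV \<phi>) \<and> compact (closure {x. \<phi> x \<noteq> 0})}"

definition Lp_loc :: "real \<Rightarrow> ('a::euclidean_space \<Rightarrow> 'b::euclidean_space) \<Rightarrow> bool" where
  "Lp_loc p g \<longleftrightarrow> g \<in> borel_measurable lebesgue \<and>
     (\<forall>K. compact K \<longrightarrow> set_integrable lebesgue K (\<lambda>x. norm (g x) powr p))"

definition is_weak_gradient :: "('a::euclidean_space \<Rightarrow> real) \<Rightarrow> ('a \<Rightarrow> 'a) \<Rightarrow> bool" where
  "is_weak_gradient u G \<longleftrightarrow>
     (\<forall>\<phi>\<in>test_functions. \<forall>b\<in>Basis.
        (LINT x|lebesgue. u x * (grad \<phi> x \<bullet> b)) = - (LINT x|lebesgue. (G x \<bullet> b) * \<phi> x))"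

text \<open>\<open>W1p_loc p u G\<close>: \<open>u\<close> lies in the local Sobolev space of order one and exponent \<open>p\<close> on
  the whole space, and \<open>G\<close> represents its weak gradient, which is unique up to null sets.\<close>

definition W1p_loc :: "real \<Rightarrow> ('a::euclidean_space \<Rightarrow> real) \<Rightarrow> ('a \<Rightarrow> 'a) \<Rightarrow> bool" where
  "W1p_loc p u G \<longleftrightarrow> Lp_loc p u \<and> Lp_loc p G \<and> is_weak_gradient u G"

text \<open>For a hypersurface with unit normal field \<open>\<nu>\<close>, extended to a neighbourhood, the principal
  curvatures at \<open>x\<close> are the eigenvalues of the shape operator, i.e. of the derivative of \<open>\<nu>\<close>
  acting on the tangent space at \<open>x\<close>. With this sign and the outer normal, a sphere of radius
  \<open>r\<close> has principal curvatures \<open>1 / r\<close>.\<close>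

definition principal_curvature :: "('a::euclidean_space \<Rightarrow> 'a) \<Rightarrow> 'a \<Rightarrow> real \<Rightarrow> bool" where
  "principal_curvature \<nu> x \<kappa> \<longleftrightarrow>
     (\<exists>v. v \<noteq> 0 \<and> v \<bullet> \<nu> x = 0 \<and> frechet_derivative \<nu> (at x) v = \<kappa> *\<^sub>R v)"

text \<open>The normalised gradient of \<open>H\<close> is the outer unit normal of the unit ball of \<open>H\<close>; the
  gradient does not vanish where \<open>H = 1\<close>, by homogeneity.\<close>

definition uniformly_convex :: "('a::euclidean_space \<Rightarrow> real) \<Rightarrow> bool" where
  "uniformly_convex H \<longleftrightarrow>
     (\<exists>c>0. \<forall>\<xi>\<in>frontier {\<xi>. H \<xi> < 1}. \<forall>\<kappa>.
        principal_curvature (\<lambda>\<eta>. grad H \<eta> /\<^sub>R norm (grad H \<eta>)) \<xi> \<kappa> \<longrightarrow> c \<le> \<kappa>)"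

definition admissible_anisotropy :: "('a::euclidean_space \<Rightarrow> real) \<Rightarrow> bool" where
  "admissible_anisotropy H \<longleftrightarrow>
     Ck_on 2 (- {0}) H \<and> continuous_on UNIV H \<and>
     H 0 = 0 \<and> (\<forall>t>0. \<forall>\<xi>. H (t *\<^sub>R \<xi>) = t * H \<xi>) \<and>
     (\<forall>\<xi>\<in>sphere 0 1. 0 < H \<xi>) \<and>
     uniformly_convex H"

definition aniso_field :: "real \<Rightarrow> ('a::euclidean_space \<Rightarrow> real) \<Rightarrow> 'a \<Rightarrow> 'a" where
  "aniso_field p H \<xi> = (if \<xi> = 0 then 0 else (1 / p) *\<^sub>R grad (\<lambda>\<eta>. H \<eta> powr p) \<xi>)"

text \<open>Weak subsolutions of \<open>- div (a (\<nabla> u)) = f u\<close> on the whole space, with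
  \<open>a = aniso_field p H\<close>.\<close>

definition subsolution ::
  "real \<Rightarrow> ('a::euclidean_space \<Rightarrow> real) \<Rightarrow> (real \<Rightarrow> real) \<Rightarrow> ('a \<Rightarrow> real) \<Rightarrow> bool" where
  "subsolution p H f u \<longleftrightarrow>
     continuous_on UNIV u \<and>
     (\<exists>G. W1p_loc p u G \<and>
        (\<forall>\<phi>\<in>test_functions. (\<forall>x. 0 \<le> \<phi> x) \<longrightarrow>
           (LINT x|lebesgue. aniso_field p H (G x) \<bullet> grad \<phi> x)
             \<le> (LINT x|lebesgue. f (u x) * \<phi> x)))"

end

(* With g = - f the equation says div a(Du) >= g(u). Put Phi(t) = integral of g^(-1/q) over
   (t, oo), which is finite and decreasing, and test with Phi(u)^(-m) eta, where
   eta = max(0, 1 - |x|^2 / R^2)^k. For m = (p - 1) q / (q - p + 1), Young's inequality with the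
   three exponents (p - 1)/p, (p - 1)/(p q), (q - p + 1)/(p q) absorbs the term with the gradient of
   eta, all powers of Phi and g cancelling, and leaves an error O(R^(- p q / (q - p + 1))) per unit
   volume. The hypotheses on q say exactly that n < p q / (q - p + 1), so R -> oo forces the
   integral of g(u) Phi(u)^(-m) to vanish. Since only C^1 regularity of Phi is available, the test
   function is approximated by composing with a mollification of u. *)

theory Submission
  imports Defs
begin

section \<open>Smooth functions and mollifiers\<close>

text \<open>Since Phi decreases, Phi(u)^(-m) increases with u, so the term in which the derivative
  falls on it has the favourable sign: coercivity bounds it below by a multiple of |Du|^p Phi^(-m-1)
  g^(-1/q) eta. The cross term, of size |Du|^(p-1) |D eta| Phi^(-m), is played against this and
  against half of g Phi^(-m) eta; the other half survives. Differentiating eta lowers the power of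
  the cutoff by one, and the exponent k is taken large so that the loss can be afforded. The
  integral condition says nothing near 0, where Phi may be unbounded. This does no harm: u is
  continuous and positive, so on each ball its values stay in a compact part of (0, oo). The
  analytic obstacle is that the inequality is given for smooth test functions, while Du is only a
  locally p-integrable weak gradient. Smoothing u inside the test function makes the classical chain
  rule available, but the field keeps the original Du; the two gradients have to be compared in the
  limit. A second mollification, of the finished C^1 test function, leads back to the smooth
  class.\<close>

lemma grad_eqI:
  fixes g :: "'a::euclidean_space \<Rightarrow> real"
  assumes "(g has_derivative (\<lambda>v. d \<bullet> v)) (at x)"
  shows "grad g x = d"
  unfolding grad_def frechet_derivative_at[OF assms, symmetric] by (rule euclidean_representation)

lemma has_derivative_grad:
  fixes g :: "'a::euclidean_space \<Rightarrow> real"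
  assumes "g differentiable (at x)"
  shows "(g has_derivative (\<lambda>v. grad g x \<bullet> v)) (at x)"
proof -
  have d: "(g has_derivative frechet_derivative g (at x)) (at x)"
    using assms frechet_derivative_works by blast
  then interpret linear "frechet_derivative g (at x)"
    by (rule has_derivative_linear)
  have "frechet_derivative g (at x) v = grad g x \<bullet> v" for v
  proof -
    have "frechet_derivative g (at x) (\<Sum>b\<in>Basis. (v \<bullet> b) *\<^sub>R b)
      = (\<Sum>b\<in>Basis. (v \<bullet> b) * frechet_derivative g (at x) b)"
      by (simp add: sum scale)
    then show ?thesis
      unfolding euclidean_representation by (simp add: grad_def inner_sum_right inner_sum_left inner_commute mult.commute)
  qed
  then show ?thesis using d by presburger
qed

text \<open>\<open>frechet_derivative\<close> is a choice operator, so smoothness is checked by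
  exhibiting an explicit derivative \<open>D\<close> and recursing on its partials; uniqueness of
  the derivative identifies the two.\<close>

lemma Ck_on_SucI:
  assumes "\<And>x. (g has_derivative D x) (at x)" and "\<And>b. b \<in> Basis \<Longrightarrow> Ck_on k UNIV (\<lambda>x. D x b)"
  shows "Ck_on (Suc k) UNIV g"
proof -
  have "frechet_derivative g (at x) = D x" for x
    using frechet_derivative_at[OF assms(1)] by simp
  then show ?thesis using assms by (auto simp: differentiable_def)
qed

lemma Ck_on_Suc_has_derivative:
  assumes "Ck_on (Suc k) UNIV g"
  shows "(g has_derivative frechet_derivative g (at x)) (at x)"
  using assms frechet_derivative_works by auto

lemma Ck_on_continuous: "Ck_on k UNIV g \<Longrightarrow> continuous_on UNIV g"
  by (cases k) (auto intro: continuous_at_imp_continuous_on differentiable_imp_continuous_within)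

lemma Ck_on_SucD: "Ck_on (Suc k) UNIV g \<Longrightarrow> Ck_on k UNIV g"
proof (induction k arbitrary: g)
  case 0
  then show ?case by (metis Ck_on.simps(1) Ck_on_continuous)
next
  case (Suc k)
  then show ?case by (metis Ck_on.simps(2))
qed

lemma Ck_on_add: "Ck_on k UNIV f \<Longrightarrow> Ck_on k UNIV g \<Longrightarrow> Ck_on k UNIV (\<lambda>x. f x + g x)"
proof (induction k arbitrary: f g)
  case 0
  then show ?case by (simp add: continuous_on_add)
next
  case (Suc k)
  show ?case
    by (rule Ck_on_SucI[OF has_derivative_add[OF Ck_on_Suc_has_derivative[OF Suc.prems(1)]
      Ck_on_Suc_has_derivative[OF Suc.prems(2)]]]) (use Suc in auto)
qed

lemma Ck_on_mult: "Ck_on k UNIV f \<Longrightarrow> Ck_on k UNIV g \<Longrightarrow> Ck_on k UNIV (\<lambda>x. f x * g x)"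
proof (induction k arbitrary: f g)
  case 0
  then show ?case by (simp add: continuous_on_mult)
next
  case (Suc k)
  have "Ck_on k UNIV f" "Ck_on k UNIV g"
    using Suc.prems Ck_on_SucD by auto
  with Suc show ?case
    by (intro Ck_on_SucI[OF has_derivative_mult[OF Ck_on_Suc_has_derivative[OF Suc.prems(1)]
      Ck_on_Suc_has_derivative[OF Suc.prems(2)]]] Ck_on_add) auto
qed

lemma Ck_on_const: "Ck_on k UNIV (\<lambda>x::'a::euclidean_space. c)"
proof (induction k arbitrary: c)
  case (Suc k)
  show ?case by (rule Ck_on_SucI[OF has_derivative_const]) (rule Suc)
qed simp

lemma Ck_on_inner: "Ck_on k UNIV (\<lambda>x::'a::euclidean_space. c * (x \<bullet> b))"
proof (cases k)
  case (Suc l)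
  show ?thesis unfolding Suc
    by (rule Ck_on_SucI[where D="\<lambda>x v. c * (v \<bullet> b)"])
      (auto intro!: derivative_eq_intros Ck_on_const)
qed (auto intro!: continuous_intros)

lemma Ck_on_translation: "Ck_on k UNIV \<rho> \<Longrightarrow> Ck_on k UNIV (\<lambda>y. \<rho> (y - x))"
proof (induction k arbitrary: \<rho>)
  case 0
  then show ?case by (auto intro!: continuous_on_compose2[of UNIV \<rho>] continuous_intros)
next
  case (Suc k)
  have "((\<lambda>y. \<rho> (y - x)) has_derivative frechet_derivative \<rho> (at (y - x))) (at y)" for y
    by (rule has_derivative_compose[where f="\<lambda>y. y - x" and f'="\<lambda>y. y",
          OF _ Ck_on_Suc_has_derivative[OF Suc.prems], simplified])
      (auto intro!: derivative_eq_intros)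
  then show ?case
    by (rule Ck_on_SucI) (use Suc in auto)
qed

text \<open>Index 0 is the classical smooth function exp(-1/t), extended by 0. The factor (1/t)^j is
  carried along because differentiation then stays within the span of the family.\<close>

definition flat :: "nat \<Rightarrow> real \<Rightarrow> real" where
  "flat j t = (if t > 0 then (1 / t) ^ j * exp (- (1 / t)) else 0)"

lemma tendsto_flat_0: "(flat j \<longlongrightarrow> 0) (at_right 0)"
proof -
  have "((\<lambda>s. s ^ j / exp s) \<longlongrightarrow> 0) (at_top :: real filter)"
    by (rule tendsto_power_div_exp_0)
  then have "((\<lambda>t. (1 / t) ^ j / exp (1 / t)) \<longlongrightarrow> 0) (at_right (0::real))"
    by (rule filterlim_compose) (simp add: filterlim_inverse_at_top_right flip: inverse_eq_divide)
  then show ?thesis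
    by (rule tendsto_cong[THEN iffD1, rotated])
      (auto simp: eventually_at_filter flat_def exp_minus field_simps)
qed

lemma flat_has_derivative:
  "(flat j has_real_derivative (flat (j + 2) t - real j * flat (Suc j) t)) (at t)"
proof (cases t "0::real" rule: linorder_cases)
  case less
  have "((\<lambda>_. 0) has_real_derivative 0) (at t)" by simp
  then have "(flat j has_real_derivative 0) (at t)"
    by (rule has_field_derivative_transform_within_open[where S="{..<0}"]) (use less in \<open>auto simp: flat_def\<close>)
  then show ?thesis using less by (simp add: flat_def)
next
  case equal
  have "((\<lambda>y. (flat j y - flat j 0) / (y - 0)) \<longlongrightarrow> 0) (at_left 0)"
    by (rule tendsto_eventually) (auto simp: flat_def eventually_at_filter)
  \<comment> \<open>For \<open>y > 0\<close> the quotient equals \<open>flat (Suc j) y\<close>,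
    whose limit is already known.\<close>
  moreover have "((\<lambda>y. (flat j y - flat j 0) / (y - 0)) \<longlongrightarrow> 0) (at_right 0)"
    by (rule tendsto_cong[THEN iffD1, OF _ tendsto_flat_0[of "Suc j"]])
      (auto simp: flat_def eventually_at_filter)
  ultimately have "(flat j has_real_derivative 0) (at 0)"
    by (simp add: has_field_derivative_iff filterlim_split_at)
  then show ?thesis using equal by (simp add: flat_def)
next
  case greater
  have d: "((\<lambda>t. 1 / t) has_real_derivative - ((1 / t)\<^sup>2)) (at t)"
    using greater by (auto intro!: derivative_eq_intros simp: power2_eq_square)
  have "((\<lambda>t. (1 / t) ^ j * exp (- (1 / t))) has_real_derivative
    (flat (j + 2) t - real j * flat (Suc j) t)) (at t)"
  proof (rule DERIV_cong[OF DERIV_mult[OF DERIV_power[OF d] DERIV_chain2[OF DERIV_exp DERIV_minus[OF d]]]])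
    show "real j * (- (1 / t)\<^sup>2 * (1 / t) ^ (j - Suc 0)) * exp (- (1 / t)) +
      exp (- (1 / t)) * - (- (1 / t)\<^sup>2) * (1 / t) ^ j = flat (j + 2) t - real j * flat (Suc j) t"
      \<comment> \<open>The case split deals with the truncated exponent
        \<open>j - Suc 0\<close>.\<close>
      using greater by (cases j) (simp_all add: flat_def power2_eq_square algebra_simps del: power_one_over)
  qed
  then show ?thesis
    by (rule has_field_derivative_transform_within_open[where S="{0<..}"]) (use greater in \<open>auto simp: flat_def\<close>)
qed

text \<open>The index \<open>j\<close> is general because one differentiation produces the indices
  \<open>j + 1\<close> and \<open>j + 2\<close>, times a linear function of \<open>y\<close>. The
  inner function is a polynomial, so the origin is no exception.\<close>

lemma Ck_on_flat_norm: "Ck_on k UNIV (\<lambda>y::'a::euclidean_space. flat j (e - y \<bullet> y))"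
proof (induction k arbitrary: j)
  case 0
  have "continuous_on UNIV (flat j)"
    by (meson DERIV_isCont continuous_at_imp_continuous_on flat_has_derivative)
  then show ?case
    by (auto intro!: continuous_on_compose2[of UNIV "flat j"] continuous_intros)
next
  case (Suc k)
  have "((\<lambda>y. flat j (e - y \<bullet> y)) has_derivative
      (\<lambda>v. (flat (j + 2) (e - y \<bullet> y) + (- real j) * flat (Suc j) (e - y \<bullet> y)) * (- 2 * (y \<bullet> v)))) (at y)"
    for y :: 'a
  proof -
    have "((\<lambda>y. e - y \<bullet> y) has_derivative (\<lambda>v. - 2 * (y \<bullet> v))) (at y)"
      by (auto intro!: derivative_eq_intros simp: inner_commute)
    from has_derivative_compose[OF this flat_has_derivative[unfolded has_field_derivative_def]]
    show ?thesis by simp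
  qed
  then show ?case
    by (rule Ck_on_SucI) (intro Ck_on_mult Ck_on_add Ck_on_inner Ck_on_const Suc)
qed

definition smooth :: "('a::euclidean_space \<Rightarrow> real) \<Rightarrow> bool" where
  "smooth \<rho> \<longleftrightarrow> (\<forall>k. Ck_on k UNIV \<rho>)"

lemma smooth_differentiable: "smooth \<rho> \<Longrightarrow> \<rho> differentiable (at x)"
  unfolding smooth_def by (metis Ck_on.simps(2) UNIV_I)

lemma smooth_continuous: "smooth \<rho> \<Longrightarrow> continuous_on UNIV \<rho>"
  unfolding smooth_def using Ck_on_continuous by blast

lemma smooth_grad_inner:
  assumes "smooth \<rho>" "b \<in> Basis"
  shows "smooth (\<lambda>x. grad \<rho> x \<bullet> b)"
proof -
  have "frechet_derivative \<rho> (at x) b = grad \<rho> x \<bullet> b" for x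
    by (metis assms(1) frechet_derivative_at has_derivative_grad smooth_differentiable)
  then show ?thesis
    using assms unfolding smooth_def by (metis (no_types, lifting) Ck_on.simps(2) ext)
qed

lemma continuous_on_smooth_grad:
  assumes "smooth \<rho>" shows "continuous_on UNIV (grad \<rho>)"
  using assms by (subst continuous_on_componentwise) (auto intro: smooth_continuous smooth_grad_inner)

lemma grad_zero_outside:
  fixes \<rho> :: "'a::euclidean_space \<Rightarrow> real"
  assumes "\<And>x. r \<le> norm x \<Longrightarrow> \<rho> x = 0" "smooth \<rho>" "r \<le> norm x"
  shows "grad \<rho> x = 0"
proof -
  have z: "grad \<rho> x = 0" if "r < norm x" for x
  proof (rule grad_eqI)
    have "((\<lambda>_. 0) has_derivative (\<lambda>v. 0)) (at x)" by simp
    then have "(\<rho> has_derivative (\<lambda>v. 0)) (at x)"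
    proof (rule has_derivative_transform_within_open[where s="- cball 0 r"])
      show "x \<in> - cball 0 r" using that by simp
    qed (use assms in auto)
    then show "(\<rho> has_derivative (\<lambda>v. 0 \<bullet> v)) (at x)" by simp
  qed
  show ?thesis
  proof (cases "x = 0")
    case True
    \<comment> \<open>Here \<open>r \<le> 0\<close>, so the vanishing hypothesis covers the whole
      space.\<close>
    then have "\<rho> = (\<lambda>_. 0)" using assms by (auto intro!: ext simp: order_trans)
    then show ?thesis by (intro grad_eqI) auto
  next
    case False
    \<comment> \<open>\<open>x\<close> may lie on the sphere of radius \<open>r\<close>, with no
      neighbourhood outside the ball; the gradient there is the limit of its values along the
      outgoing ray.\<close>
    have "((\<lambda>t. grad \<rho> ((1 + t) *\<^sub>R x)) \<longlongrightarrow> grad \<rho> ((1 + 0) *\<^sub>R x)) (at_right (0::real))"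
      by (rule isCont_tendsto_compose[where g="grad \<rho>"])
        (use continuous_on_smooth_grad[OF assms(2)] in
          \<open>auto simp: continuous_on_eq_continuous_at intro!: tendsto_eq_intros\<close>)
    moreover have "\<forall>\<^sub>F t in at_right (0::real). grad \<rho> ((1 + t) *\<^sub>R x) = 0"
      unfolding eventually_at_filter
    proof (intro always_eventually allI impI z)
      fix t :: real assume "t \<noteq> 0" "t \<in> {0<..}"
      then show "r < norm ((1 + t) *\<^sub>R x)"
        using False assms(3) by (simp add: less_le_trans[of r] order_le_less_trans[OF assms(3)])
    qed
    ultimately show ?thesis
      using tendsto_unique[OF _ _ tendsto_eventually] by (metis add.right_neutral scaleR_one trivial_limit_at_right_real)
  qed
qed

section \<open>Bounded supports, test functions and mollifiers\<close>

lemma test_functionsI: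
  fixes \<rho> :: "'a::euclidean_space \<Rightarrow> real"
  assumes "smooth \<rho>" "\<And>x. r \<le> norm x \<Longrightarrow> \<rho> x = 0"
  shows "\<rho> \<in> test_functions"
proof -
  have "bounded {x. \<rho> x \<noteq> 0}"
    using assms(2) by (auto intro!: boundedI[where B=r]) (meson linear)
  then show ?thesis using assms(1) by (simp add: test_functions_def smooth_def)
qed

lemma integrable_continuous_bounded_support:
  fixes h :: "'a::euclidean_space \<Rightarrow> 'b::{banach, second_countable_topology}"
  assumes "continuous_on UNIV h" and "\<And>x. r \<le> norm x \<Longrightarrow> h x = 0"
  shows "integrable lborel h"
proof -
  have "h = (\<lambda>x. indicator (cball 0 r) x *\<^sub>R h x)"
    using assms(2) by (auto simp: indicator_def)
  moreover have "integrable lborel (\<lambda>x. indicator (cball 0 r) x *\<^sub>R h x)"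
    by (rule borel_integrable_compact) (use assms(1) continuous_on_subset in auto)
  ultimately show ?thesis by simp
qed

definition mollifier :: "real \<Rightarrow> ('a::euclidean_space \<Rightarrow> real) \<Rightarrow> bool" where
  "mollifier e \<rho> \<longleftrightarrow> smooth \<rho> \<and> (\<forall>x. 0 \<le> \<rho> x) \<and> (\<forall>x. e \<le> norm x \<longrightarrow> \<rho> x = 0) \<and>
     (LINT x|lborel. \<rho> x) = 1"

lemma mollifierD:
  assumes "mollifier e \<rho>"
  shows "smooth \<rho>" "0 \<le> \<rho> x" "e \<le> norm x \<Longrightarrow> \<rho> x = 0" "(LINT x|lborel. \<rho> x) = 1"
    "continuous_on UNIV \<rho>" "integrable lborel \<rho>"
  using assms integrable_continuous_bounded_support[OF smooth_continuous]
  unfolding mollifier_def by (auto simp: smooth_continuous)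

lemma mollifier_exists:
  assumes "0 < e"
  shows "\<exists>\<rho> :: 'a::euclidean_space \<Rightarrow> real. mollifier e \<rho>"
proof -
  define h :: "'a \<Rightarrow> real" where "h y = flat 0 (e\<^sup>2 - y \<bullet> y)" for y
  have sm: "smooth h" unfolding smooth_def h_def using Ck_on_flat_norm by blast
  have nn: "0 \<le> h x" for x by (simp add: h_def flat_def)
  have out: "h x = 0" if "e \<le> norm x" for x
  proof -
    have "e\<^sup>2 \<le> (norm x)\<^sup>2" using that assms by (intro power_mono) auto
    then show ?thesis by (simp add: h_def flat_def dot_square_norm)
  qed
  have pos: "0 < h x" if "norm x < e" for x
    using that assms by (auto simp: h_def flat_def dot_square_norm power_strict_mono)
  have int: "integrable lborel h"
    using integrable_continuous_bounded_support[OF smooth_continuous[OF sm]] out by blast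
  have "0 < (LINT x|lborel. h x)"
  proof -
    have "(LINT x|lborel. h x) \<noteq> 0"
    proof
      assume "(LINT x|lborel. h x) = 0"
      then have "AE x in lborel. h x = 0"
        using integral_nonneg_eq_0_iff_AE[OF int] nn by simp
      then have "AE x in lborel. x \<notin> ball (0::'a) e"
        by eventually_elim (use pos in force)
      then have "ball (0::'a) e \<in> null_sets lborel"
        by (subst AE_iff_null_sets) auto
      then show False
        using assms open_not_negligible[of "ball (0::'a) e"]
        by (auto simp: negligible_iff_null_sets intro: null_sets_completionI)
    qed
    moreover have "0 \<le> (LINT x|lborel. h x)" using nn by simp
    ultimately show ?thesis by linarith
  qed
  with sm nn out int show ?thesis
    by (intro exI[of _ "\<lambda>x. inverse (LINT x|lborel. h x) * h x"])
      (auto simp: mollifier_def smooth_def Ck_on_mult Ck_on_const)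
qed

section \<open>Mollification\<close>

lemma has_derivative_imp_continuous_on_UNIV:
  assumes "\<And>x. (f has_derivative g x) (at x)"
  shows "continuous_on UNIV f"
  using assms by (meson continuous_at_imp_continuous_on has_derivative_continuous)

text \<open>For \<open>x\<close> in a unit ball around \<open>x0\<close> the integrands all vanish
  outside one bounded set, so the integral is over a box independent of \<open>x\<close> and the
  Leibniz rule for boxes applies. Derivatives are given as gradient vectors, so that their integral
  is again a vector.\<close>

lemma has_derivative_integral_bounded_support:
  fixes F :: "'a::euclidean_space \<Rightarrow> 'a \<Rightarrow> real" and D :: "'a \<Rightarrow> 'a \<Rightarrow> 'a"
  assumes der: "\<And>x z. ((\<lambda>x. F x z) has_derivative (\<lambda>v. D x z \<bullet> v)) (at x)"
    and contF: "\<And>x. continuous_on UNIV (F x)"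
    and contD: "continuous_on UNIV (\<lambda>(x, z). D x z)"
    and F0: "\<And>x z. x \<in> ball x0 1 \<Longrightarrow> r \<le> norm z \<Longrightarrow> F x z = 0"
    and D0: "\<And>x z. x \<in> ball x0 1 \<Longrightarrow> r \<le> norm z \<Longrightarrow> D x z = 0"
  shows "((\<lambda>x. LINT z|lborel. F x z) has_derivative (\<lambda>v. (LINT z|lborel. D x0 z) \<bullet> v)) (at x0)"
proof -
  obtain a b :: 'a where ab: "cball 0 r \<subseteq> cbox a b"
    using bounded_subset_cbox_symmetric[OF bounded_cball, of 0 r] by blast
  have contD': "continuous_on UNIV (D x)" for x
  proof -
    have "continuous_on UNIV (\<lambda>z. case (x, z) of (x, z) \<Rightarrow> D x z)"
      by (rule continuous_on_compose2[OF contD]) (auto intro!: continuous_intros)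
    then show ?thesis by simp
  qed
  have conv: "(LINT z|lborel. f z) = integral (cbox a b) f"
    if "continuous_on UNIV f" "\<And>z. r \<le> norm z \<Longrightarrow> f z = 0"
    for f :: "'a \<Rightarrow> 'b::euclidean_space"
  proof -
    have "f = (\<lambda>z. if z \<in> cbox a b then f z else 0)"
    proof
      fix z show "f z = (if z \<in> cbox a b then f z else 0)"
        using subsetD[OF ab, of z] that(2)[of z] by (cases "r \<le> norm z") auto
    qed
    then have "integral UNIV f = integral (cbox a b) f"
      by (metis Henstock_Kurzweil_Integration.integral_restrict_UNIV)
    then show ?thesis
      using integral_lborel[OF integrable_continuous_bounded_support[OF that]] by simp
  qed
  have "((\<lambda>x. integral (cbox a b) (F x)) has_derivative
      integral (cbox a b) (\<lambda>z. blinfun_inner_right (D x0 z))) (at x0 within ball x0 1)"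
  proof (rule leibniz_rule)
    show "continuous_on (ball x0 1 \<times> cbox a b) (\<lambda>(x, t). blinfun_inner_right (D x t))"
      using continuous_on_subset[OF contD, of "ball x0 1 \<times> cbox a b"]
      by (auto simp: split_beta intro!: continuous_intros)
    show "F x integrable_on cbox a b" for x
      by (rule integrable_continuous) (use contF continuous_on_subset in blast)
  qed (auto intro!: has_derivative_at_withinI[OF der])
  then have "((\<lambda>x. integral (cbox a b) (F x)) has_derivative
      integral (cbox a b) (\<lambda>z. blinfun_inner_right (D x0 z))) (at x0)"
    by (simp add: at_within_open[of x0 "ball x0 1"])
  moreover have "blinfun_apply (integral (cbox a b) (\<lambda>z. blinfun_inner_right (D x0 z)))
    = (\<lambda>v. (LINT z|lborel. D x0 z) \<bullet> v)"
  proof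
    fix v
    have c: "continuous_on (cbox a b) (D x0)" using contD' continuous_on_subset by blast
    have "blinfun_apply (integral (cbox a b) (\<lambda>z. blinfun_inner_right (D x0 z))) v
       = integral (cbox a b) (\<lambda>z. D x0 z \<bullet> v)"
      by (subst blinfun_apply_integral) (auto intro!: integrable_continuous continuous_intros c)
    also have "\<dots> = (LINT z|lborel. D x0 z \<bullet> v)"
      by (rule conv[symmetric]) (auto intro!: continuous_intros contD' simp: D0)
    also have "\<dots> = (LINT z|lborel. D x0 z) \<bullet> v"
      by (rule integral_inner_left)
        (auto intro!: integrable_continuous_bounded_support[OF contD'] D0)
    finally show "blinfun_apply (integral (cbox a b) (\<lambda>z. blinfun_inner_right (D x0 z))) v
      = (LINT z|lborel. D x0 z) \<bullet> v" .
  qed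
  ultimately have "((\<lambda>x. integral (cbox a b) (F x)) has_derivative
      (\<lambda>v. (LINT z|lborel. D x0 z) \<bullet> v)) (at x0)" by simp
  then show ?thesis
  proof (rule has_derivative_transform_within_open[where s="ball x0 1"])
    show "integral (cbox a b) (F x) = (LINT z|lborel. F x z)" if "x \<in> ball x0 1" for x
      using conv[OF contF] F0 that by metis
  qed auto
qed

text \<open>Correlation rather than convolution: a weighted average of the translates
  \<open>w (x + z)\<close>, so the kernel is not reflected and need not be even. The codomain is
  general because both \<open>u\<close> and its weak gradient are mollified.\<close>

definition mollify :: "('a::euclidean_space \<Rightarrow> real) \<Rightarrow> ('a \<Rightarrow> 'b::euclidean_space) \<Rightarrow> 'a \<Rightarrow> 'b" where
  "mollify \<rho> w x = (LINT z|lborel. \<rho> z *\<^sub>R w (x + z))"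

lemma integral_lborel_translation:
  fixes f :: "'a::euclidean_space \<Rightarrow> 'b::{banach, second_countable_topology}"
  assumes "f \<in> borel_measurable borel"
  shows "(LINT z|lborel. f (c + z)) = (LINT z|lborel. f z)"
  using integral_distr[of "(+) c" lborel borel f] assms by (simp add: lborel_distr_plus)

lemma mollify_eq:
  assumes "w \<in> borel_measurable borel" "continuous_on UNIV \<rho>"
  shows "mollify \<rho> w x = (LINT y|lborel. \<rho> (y - x) *\<^sub>R w y)"
proof -
  have [measurable]: "\<rho> \<in> borel_measurable borel"
    using assms by (simp add: borel_measurable_continuous_onI)
  note [measurable] = assms(1)
  show ?thesis
    using integral_lborel_translation[of "\<lambda>y. \<rho> (y - x) *\<^sub>R w y" x] by (simp add: mollify_def)
qed

text \<open>The derivative falls on \<open>w\<close>; this is the version for smoothing a C^1 test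
  function.\<close>

lemma mollify_has_derivative_right:
  fixes w :: "'a::euclidean_space \<Rightarrow> real"
  assumes w: "\<And>x. (w has_derivative (\<lambda>v. D x \<bullet> v)) (at x)" "continuous_on UNIV D"
    and \<rho>: "continuous_on UNIV \<rho>" "\<And>z. r \<le> norm z \<Longrightarrow> \<rho> z = 0"
  shows "(mollify \<rho> w has_derivative (\<lambda>v. mollify \<rho> D x \<bullet> v)) (at x)"
  unfolding mollify_def[abs_def]
proof (rule has_derivative_integral_bounded_support[where r=r])
  have cw: "continuous_on UNIV w"
    using w(1) by (meson continuous_at_imp_continuous_on has_derivative_continuous)
  show "continuous_on UNIV (\<lambda>z. \<rho> z *\<^sub>R w (x + z))" for x
    by (intro continuous_intros \<rho> continuous_on_compose2[OF cw]) auto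
  show "continuous_on UNIV (\<lambda>(x, z). \<rho> z *\<^sub>R D (x + z))"
    unfolding split_beta
    by (intro continuous_intros continuous_on_compose2[OF \<rho>(1)] continuous_on_compose2[OF w(2)]) auto
  show "((\<lambda>x. \<rho> z *\<^sub>R w (x + z)) has_derivative (\<lambda>v. (\<rho> z *\<^sub>R D (x + z)) \<bullet> v)) (at x)" for x z
  proof -
    have "((\<lambda>x. w (x + z)) has_derivative (\<lambda>v. D (x + z) \<bullet> v)) (at x)"
      by (rule has_derivative_compose[where f="\<lambda>x. x + z" and f'="\<lambda>v. v", OF _ w(1)])
        (auto intro!: derivative_eq_intros)
    then show ?thesis by (auto intro!: derivative_eq_intros)
  qed
qed (use \<rho> in auto)

text \<open>Here \<open>w\<close> is only continuous, so the kernel carries the derivative: after a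
  translation it reads \<open>\<rho> (y - x)\<close>, which explains the minus sign.\<close>

lemma mollify_has_derivative_left:
  fixes w :: "'a::euclidean_space \<Rightarrow> real"
  assumes w: "continuous_on UNIV w" and \<rho>: "smooth \<rho>" "\<And>z. r \<le> norm z \<Longrightarrow> \<rho> z = 0"
  shows "(mollify \<rho> w has_derivative (\<lambda>v. (LINT y|lborel. - w y *\<^sub>R grad \<rho> (y - x)) \<bullet> v)) (at x)"
proof -
  have eq: "mollify \<rho> w = (\<lambda>x. LINT y|lborel. \<rho> (y - x) *\<^sub>R w y)"
    using mollify_eq[OF borel_measurable_continuous_onI[OF w] smooth_continuous[OF \<rho>(1)]] by blast
  show ?thesis unfolding eq
  proof (rule has_derivative_integral_bounded_support[where r="norm x + 1 + r"])
    show "continuous_on UNIV (\<lambda>y. \<rho> (y - x) *\<^sub>R w y)" for x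
      by (intro continuous_intros w continuous_on_compose2[OF smooth_continuous[OF \<rho>(1)]]) auto
    show "continuous_on UNIV (\<lambda>(x, y). - w y *\<^sub>R grad \<rho> (y - x))"
      unfolding split_beta
      by (intro continuous_intros continuous_on_compose2[OF w]
          continuous_on_compose2[OF continuous_on_smooth_grad[OF \<rho>(1)]]) auto
    show "((\<lambda>x. \<rho> (y - x) *\<^sub>R w y) has_derivative (\<lambda>v. (- w y *\<^sub>R grad \<rho> (y - x)) \<bullet> v)) (at x)" for x y
    proof -
      have "((\<lambda>x. \<rho> (y - x)) has_derivative (\<lambda>v. grad \<rho> (y - x) \<bullet> (- v))) (at x)"
        by (rule has_derivative_compose[where f="\<lambda>x. y - x" and f'="\<lambda>v. - v",
              OF _ has_derivative_grad[OF smooth_differentiable[OF \<rho>(1)]]])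
          (auto intro!: derivative_eq_intros)
      then show ?thesis by (auto intro!: derivative_eq_intros)
    qed
    fix z y :: 'a assume "z \<in> ball x 1" "norm x + 1 + r \<le> norm y"
    then have "r \<le> norm (y - z)"
      using norm_triangle_ineq2[of y z] norm_triangle_ineq2[of z x] by (simp add: dist_norm norm_minus_commute)
    then show "\<rho> (y - z) *\<^sub>R w y = 0" "- w y *\<^sub>R grad \<rho> (y - z) = 0"
      using grad_zero_outside[OF \<rho>(2,1)] \<rho>(2) by auto
  qed
qed

text \<open>Each partial derivative is, up to sign, a mollification by a partial derivative of
  \<open>\<rho>\<close>. The induction therefore runs over all smooth kernels of bounded support:
  the differentiated kernel is neither nonnegative nor of mass 1 in general.\<close>

lemma smooth_mollify:
  fixes w :: "'a::euclidean_space \<Rightarrow> real"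
  assumes w: "continuous_on UNIV w" and \<rho>: "smooth \<rho>" "\<And>z. r \<le> norm z \<Longrightarrow> \<rho> z = 0"
  shows "smooth (mollify \<rho> w)"
proof -
  have "Ck_on k UNIV (mollify \<rho> w)" for k using \<rho>
  proof (induction k arbitrary: \<rho>)
    case 0
    show ?case
      using has_derivative_imp_continuous_on_UNIV[OF mollify_has_derivative_left[OF w 0]] by simp
  next
    case (Suc k)
    show ?case
    proof (rule Ck_on_SucI[OF mollify_has_derivative_left[OF w Suc.prems]])
      fix b :: 'a assume b: "b \<in> Basis"
      have g0: "grad \<rho> z \<bullet> b = 0" if "r \<le> norm z" for z
        using grad_zero_outside[OF Suc.prems(2,1) that] by simp
      note sg = smooth_grad_inner[OF Suc.prems(1) b]
      have "(LINT y|lborel. - w y *\<^sub>R grad \<rho> (y - x)) \<bullet> b = (-1) * mollify (\<lambda>z. grad \<rho> z \<bullet> b) w x" for x :: 'a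
      proof -
        have c: "continuous_on UNIV (\<lambda>y. - w y *\<^sub>R grad \<rho> (y - x))"
          by (intro continuous_intros w continuous_on_compose2[OF continuous_on_smooth_grad[OF Suc.prems(1)]]) auto
        have "integrable lborel (\<lambda>y. - w y *\<^sub>R grad \<rho> (y - x))"
        proof (rule integrable_continuous_bounded_support[OF c, of "norm x + r"])
          fix y :: 'a assume "norm x + r \<le> norm y"
          then have "r \<le> norm (y - x)" using norm_triangle_ineq2[of y x] by simp
          then show "- w y *\<^sub>R grad \<rho> (y - x) = 0" using grad_zero_outside[OF Suc.prems(2,1)] by simp
        qed
        then have "(LINT y|lborel. - w y *\<^sub>R grad \<rho> (y - x)) \<bullet> b = (LINT y|lborel. (- w y *\<^sub>R grad \<rho> (y - x)) \<bullet> b)"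
          by (simp only: integral_inner_left)
        also have "\<dots> = (-1) * mollify (\<lambda>z. grad \<rho> z \<bullet> b) w x"
          by (simp add: mollify_eq[OF borel_measurable_continuous_onI[OF w] smooth_continuous[OF sg]] mult.commute)
        finally show ?thesis .
      qed
      then show "Ck_on k UNIV (\<lambda>x. (LINT y|lborel. - w y *\<^sub>R grad \<rho> (y - x)) \<bullet> b)"
        by (simp only:) (intro Ck_on_mult Ck_on_const Suc.IH sg g0)
    qed
  qed
  then show ?thesis by (simp add: smooth_def)
qed

section \<open>Pointwise control of mollifications of continuous functions\<close>

lemma integrable_mollify:
  fixes w :: "'a::euclidean_space \<Rightarrow> 'b::euclidean_space"
  assumes "continuous_on UNIV w" "mollifier e \<rho>"
  shows "integrable lborel (\<lambda>z. \<rho> z *\<^sub>R w (x + z))"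
  by (rule integrable_continuous_bounded_support[where r=e])
    (use assms mollifierD in \<open>auto intro!: continuous_intros continuous_on_compose2[OF assms(1)]\<close>)

lemma mollify_dist_le:
  fixes w :: "'a::euclidean_space \<Rightarrow> 'b::euclidean_space"
  assumes "continuous_on UNIV w" "mollifier e \<rho>" "\<And>z. norm z \<le> e \<Longrightarrow> norm (w (x + z) - w x) \<le> d"
  shows "norm (mollify \<rho> w x - w x) \<le> d"
proof -
  note \<rho> = mollifierD[OF assms(2)]
  note i = integrable_mollify[OF assms(1,2)]
  have "w x = (LINT z|lborel. \<rho> z *\<^sub>R w x)" using \<rho> by simp
  then have "mollify \<rho> w x - w x = (LINT z|lborel. \<rho> z *\<^sub>R w (x + z) - \<rho> z *\<^sub>R w x)"
    unfolding mollify_def using \<rho> by (subst Bochner_Integration.integral_diff) (auto intro: i)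
  also have "norm \<dots> \<le> (LINT z|lborel. \<rho> z * d)"
  proof (rule Bochner_Integration.integral_norm_bound_integral)
    show "norm (\<rho> z *\<^sub>R w (x + z) - \<rho> z *\<^sub>R w x) \<le> \<rho> z * d" for z
    proof (cases "norm z \<le> e")
      case True
      have "norm (\<rho> z *\<^sub>R w (x + z) - \<rho> z *\<^sub>R w x) = \<rho> z * norm (w (x + z) - w x)"
        using \<rho> by (simp flip: scaleR_diff_right)
      with True show ?thesis using \<rho>(2)[of z] assms(3)[of z] by (simp add: mult_left_mono)
    next
      case False
      then show ?thesis using \<rho>(3)[of z] by simp
    qed
  qed (use \<rho> i in auto)
  finally show ?thesis using \<rho> by simp
qed

lemma mollify_lower_bound:
  fixes w :: "'a::euclidean_space \<Rightarrow> real"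
  assumes "continuous_on UNIV w" "mollifier e \<rho>" "\<And>z. norm z \<le> e \<Longrightarrow> c \<le> w (x + z)"
  shows "c \<le> mollify \<rho> w x"
proof -
  note \<rho> = mollifierD[OF assms(2)]
  have "(LINT z|lborel. \<rho> z * c) \<le> (LINT z|lborel. \<rho> z *\<^sub>R w (x + z))"
  proof (rule integral_mono)
    show "\<rho> z * c \<le> \<rho> z *\<^sub>R w (x + z)" for z
      using \<rho>(2,3)[of z] assms(3)[of z] by (cases "norm z \<le> e") (auto simp: mult_left_mono)
  qed (use \<rho> integrable_mollify[OF assms(1,2)] in auto)
  then show ?thesis using \<rho> by (simp add: mollify_def)
qed

lemma mollify_zero_outside:
  assumes "mollifier e \<rho>" "\<And>x. R \<le> norm x \<Longrightarrow> w x = 0" "R + e \<le> norm x"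
  shows "mollify \<rho> w x = 0"
proof -
  have "\<rho> z *\<^sub>R w (x + z) = 0" for z
  proof (cases "e \<le> norm z")
    case False
    then have "R \<le> norm (x + z)" using norm_triangle_ineq2[of x "-z"] assms(3) by simp
    then show ?thesis using assms(2) by simp
  qed (use mollifierD[OF assms(1)] in simp)
  then show ?thesis unfolding mollify_def by (simp only: Bochner_Integration.integral_zero)
qed

lemma uniform_translation:
  fixes w :: "'a::euclidean_space \<Rightarrow> 'b::real_normed_vector"
  assumes "continuous_on UNIV w" "0 < \<eta>"
  shows "\<exists>d>0. d \<le> 1 \<and> (\<forall>x z. norm x \<le> R \<longrightarrow> norm z \<le> d \<longrightarrow> norm (w (x + z) - w x) \<le> \<eta>)"
proof -
  have "uniformly_continuous_on (cball 0 (R + 1)) w"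
    by (rule compact_uniformly_continuous) (use assms continuous_on_subset in auto)
  then obtain d where d: "d > 0" "\<And>x y. x \<in> cball 0 (R+1) \<Longrightarrow> y \<in> cball 0 (R+1) \<Longrightarrow> dist y x < d \<Longrightarrow> dist (w y) (w x) < \<eta>"
    using assms(2) unfolding uniformly_continuous_on_def by metis
  show ?thesis
  \<comment> \<open>The bound 1 keeps \<open>x + z\<close> in the larger ball where uniform
    continuity holds; halving \<open>d\<close> makes the distance strictly smaller than
    \<open>d\<close>.\<close>
  proof (intro exI[of _ "min 1 (d / 2)"] conjI allI impI)
    fix x z :: 'a assume *: "norm x \<le> R" "norm z \<le> min 1 (d / 2)"
    then have "norm (x + z) \<le> R + 1" using norm_triangle_ineq[of x z] by simp
    then have "dist (w (x + z)) (w x) < \<eta>" using * d(1) dist_norm[of "x + z" x] by (intro d(2)) auto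
    then show "norm (w (x + z) - w x) \<le> \<eta>" by (simp add: dist_norm)
  qed (use d in auto)
qed

section \<open>Translations and mollification of locally integrable functions\<close>

text \<open>The Borel counterpart of \<open>Lp_loc\<close>: Borel measurability makes
  \<open>G (x + z)\<close> jointly measurable in \<open>x\<close> and \<open>z\<close>, which the
  exchange of integrals requires.\<close>

definition Lp_borel :: "real \<Rightarrow> ('a::euclidean_space \<Rightarrow> 'b::euclidean_space) \<Rightarrow> bool" where
  "Lp_borel p G \<longleftrightarrow> G \<in> borel_measurable borel \<and>
     (\<forall>R. integrable lborel (\<lambda>x. indicator (cball 0 R) x * norm (G x) powr p))"

section \<open>Approximation of locally p-integrable functions by continuous ones\<close>

lemma powr_add_le:
  fixes a b p :: real
  assumes "0 \<le> a" "0 \<le> b" "0 \<le> p"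
  shows "(a + b) powr p \<le> 2 powr p * (a powr p + b powr p)"
proof -
  have "(a + b) powr p \<le> (2 * max a b) powr p"
    using assms by (intro powr_mono2) auto
  also have "\<dots> = 2 powr p * max a b powr p" using assms by (simp add: powr_mult)
  also have "\<dots> \<le> 2 powr p * (a powr p + b powr p)"
    by (intro mult_left_mono) (auto simp: max_def)
  finally show ?thesis .
qed

text \<open>The radial projection onto the closed ball of radius \<open>N\<close>, written with a
  maximum in the denominator so that continuity is evident, also at the origin.\<close>

definition truncate :: "real \<Rightarrow> 'b::real_normed_vector \<Rightarrow> 'b" where
  "truncate N v = v /\<^sub>R max 1 (norm v / N)"

lemma truncate_id: "norm v \<le> N \<Longrightarrow> 0 < N \<Longrightarrow> truncate N v = v"
  by (simp add: truncate_def max_def)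

lemma norm_truncate_le:
  assumes "0 < N" shows "norm (truncate N v) \<le> N"
proof -
  have "norm v \<le> N * max 1 (norm v / N)"
    using assms by (auto simp: max_def field_simps)
  then show ?thesis
    by (simp add: truncate_def field_simps)
qed

lemma norm_truncate_diff_le: "0 < N \<Longrightarrow> norm (truncate N v - v) \<le> norm v"
proof -
  assume N: "0 < N"
  define s where "s = inverse (max 1 (norm v / N))"
  have s: "0 \<le> s" "s \<le> 1" using le_imp_inverse_le[of 1 "max 1 (norm v / N)"] by (simp_all add: s_def)
  have "truncate N v - v = (s - 1) *\<^sub>R v" by (simp add: truncate_def s_def algebra_simps)
  then have "norm (truncate N v - v) = (1 - s) * norm v" using s by simp
  also have "\<dots> \<le> norm v" using s by (simp add: mult_left_le_one_le)
  finally show ?thesis .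
qed

lemma continuous_on_truncate: "0 < N \<Longrightarrow> continuous_on UNIV (truncate N)"
  unfolding truncate_def[abs_def] by (intro continuous_intros) (auto simp: max_def)

lemma measurable_truncate [measurable]:
  "0 < N \<Longrightarrow> truncate N \<in> borel_measurable (borel :: 'b::euclidean_space measure)"
  by (rule borel_measurable_continuous_onI[OF continuous_on_truncate])

text \<open>At a fixed point the truncation is inactive once the level exceeds
  \<open>norm (G x)\<close>, and its error never exceeds \<open>norm (G x)\<close>; dominated
  convergence does the rest.\<close>

lemma truncate_approx:
  assumes G: "Lp_borel p G" and "0 < p" "0 < \<eta>"
  shows "\<exists>N>0. integrable lborel (\<lambda>x. indicator (cball 0 R) x * norm (truncate N (G x) - G x) powr p) \<and>
    (LINT x|lborel. indicator (cball 0 R) x * norm (truncate N (G x) - G x) powr p) < \<eta>"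
proof -
  have [measurable]: "G \<in> borel_measurable borel" using G by (simp add: Lp_borel_def)
  let ?s = "\<lambda>n x. indicator (cball 0 R) x * norm (truncate (real (Suc n)) (G x) - G x) powr p :: real"
  have int: "integrable lborel (\<lambda>x. indicator (cball 0 R) x * norm (G x) powr p)"
    using G by (simp add: Lp_borel_def)
  have lim0: "AE x in lborel. (\<lambda>n. ?s n x) \<longlonglongrightarrow> 0"
  proof (rule AE_I2, rule tendsto_eventually)
    fix x
    show "\<forall>\<^sub>F n in sequentially. ?s n x = 0"
      using eventually_ge_at_top[of "nat \<lceil>norm (G x)\<rceil>"]
    proof eventually_elim
      case (elim n)
      then have "truncate (real (Suc n)) (G x) = G x" by (intro truncate_id) linarith+
      then show ?case by simp
    qed
  qed
  have bnd: "AE x in lborel. norm (?s n x) \<le> indicator (cball 0 R) x * norm (G x) powr p" for n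
    using norm_truncate_diff_le[of "real (Suc n)"] assms
    by (intro AE_I2) (auto simp: indicator_def intro!: powr_mono2)
  have meas: "?s n \<in> borel_measurable lborel" for n by measurable simp_all
  note * = integrable_dominated_convergence2[OF _ meas int lim0 bnd, simplified]
    integral_dominated_convergence[OF _ meas int lim0 bnd]
  then have "\<forall>\<^sub>F n in sequentially. (LINT x|lborel. ?s n x) < \<eta>"
    using order_tendstoD(2)[OF *(2), of \<eta>] \<open>0 < \<eta>\<close> by simp
  then obtain n where "(LINT x|lborel. ?s n x) < \<eta>" by (auto simp: eventually_sequentially)
  then show ?thesis using * by (intro exI[of _ "real (Suc n)"]) auto
qed

text \<open>A measurable function is an almost everywhere limit of continuous ones. Truncating these
  at level \<open>N\<close> leaves the limit unchanged, since \<open>F\<close> is bounded by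
  \<open>N\<close>, and supplies the constant majorant \<open>(2 * N) powr p\<close> on the
  ball.\<close>

lemma bounded_approx:
  fixes F :: "'a::euclidean_space \<Rightarrow> 'b::euclidean_space"
  assumes F: "F \<in> borel_measurable borel" "\<And>x. norm (F x) \<le> N" and "0 < N" "0 < p" "0 < \<eta>"
  shows "\<exists>g. continuous_on UNIV g \<and>
    integrable lborel (\<lambda>x. indicator (cball 0 R) x * norm (g x - F x) powr p) \<and>
    (LINT x|lborel. indicator (cball 0 R) x * norm (g x - F x) powr p) < \<eta>"
proof -
  note [measurable] = F(1)
  have "F measurable_on UNIV"
    by (rule lebesgue_measurable_imp_measurable_on)
      (use F(1) in \<open>auto simp: lebesgue_on_UNIV_eq measurable_completion\<close>)
  then obtain Z g where Z: "negligible Z" and g: "\<And>n. continuous_on UNIV (g n)"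
    and lim: "\<And>x. x \<notin> Z \<Longrightarrow> (\<lambda>n. g n x) \<longlonglongrightarrow> F x"
    unfolding measurable_on_def by auto
  have cont: "continuous_on UNIV (\<lambda>x. truncate N (g n x))" for n
    by (rule continuous_on_compose2[OF continuous_on_truncate[OF \<open>0 < N\<close>] g]) auto
  have [measurable]: "(\<lambda>x. truncate N (g n x)) \<in> borel_measurable borel" for n
    by (rule borel_measurable_continuous_onI[OF cont])
  have AEZ: "AE x in lborel. x \<notin> Z"
    using Z by (metis AE_completion_iff AE_not_in negligible_iff_null_sets)
  let ?s = "\<lambda>n x. indicator (cball 0 R) x * norm (truncate N (g n x) - F x) powr p :: real"
  have int: "integrable lborel (\<lambda>x. indicator (cball 0 R) x *\<^sub>R (2 * N) powr p)"
    by (rule borel_integrable_compact) auto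
  have lim0: "AE x in lborel. (\<lambda>n. ?s n x) \<longlonglongrightarrow> 0"
    using AEZ
  proof eventually_elim
    case (elim x)
    have "(\<lambda>n. truncate N (g n x)) \<longlonglongrightarrow> truncate N (F x)"
      by (rule isCont_tendsto_compose[OF _ lim[OF elim]])
        (use continuous_on_truncate[OF \<open>0 < N\<close>] in \<open>auto simp: continuous_on_eq_continuous_at\<close>)
    then have "(\<lambda>n. norm (truncate N (g n x) - F x)) \<longlonglongrightarrow> 0"
      using F(2)[of x] \<open>0 < N\<close> by (simp add: truncate_id LIM_zero tendsto_norm_zero)
    then have "(\<lambda>n. norm (truncate N (g n x) - F x) powr p) \<longlonglongrightarrow> 0 powr p"
      using \<open>0 < p\<close> by (intro tendsto_powr') auto
    then show ?case using tendsto_mult_right_zero by fastforce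
  qed
  have bnd: "AE x in lborel. norm (?s n x) \<le> indicator (cball 0 R) x *\<^sub>R (2 * N) powr p" for n
  proof (rule AE_I2)
    fix x
    have "norm (truncate N (g n x) - F x) \<le> 2 * N"
      using norm_truncate_le[OF \<open>0 < N\<close>, of "g n x"] F(2)[of x]
        norm_triangle_ineq4[of "truncate N (g n x)" "F x"] by linarith
    then show "norm (?s n x) \<le> indicator (cball 0 R) x *\<^sub>R (2 * N) powr p"
      using \<open>0 < p\<close> by (auto simp: indicator_def intro!: powr_mono2)
  qed
  have meas: "?s n \<in> borel_measurable lborel" for n by measurable simp_all
  note * = integrable_dominated_convergence2[OF _ meas int lim0 bnd, simplified]
    integral_dominated_convergence[OF _ meas int lim0 bnd]
  then have "\<forall>\<^sub>F n in sequentially. (LINT x|lborel. ?s n x) < \<eta>"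
    using order_tendstoD(2)[OF *(2), of \<eta>] \<open>0 < \<eta>\<close> by simp
  then obtain n where "(LINT x|lborel. ?s n x) < \<eta>" by (auto simp: eventually_sequentially)
  then show ?thesis using * cont by blast
qed

lemma Lp_continuous_approx:
  fixes G :: "'a::euclidean_space \<Rightarrow> 'b::euclidean_space"
  assumes G: "Lp_borel p G" and "0 < p" "0 < \<eta>"
  shows "\<exists>g. continuous_on UNIV g \<and>
    (\<integral>\<^sup>+x. ennreal (indicator (cball 0 R) x * norm (g x - G x) powr p) \<partial>lborel) \<le> ennreal \<eta>"
proof -
  have [measurable]: "G \<in> borel_measurable borel" using G by (simp add: Lp_borel_def)
  \<comment> \<open>Two errors below \<open>\<eta>'\<close> are added, each with the factor
    \<open>2 powr p\<close> of \<open>powr_add_le\<close>.\<close>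
  define \<eta>' where "\<eta>' = \<eta> / (2 * 2 powr p)"
  have "\<eta>' > 0" using assms by (simp add: \<eta>'_def)
  obtain N where N: "N > 0"
    "integrable lborel (\<lambda>x. indicator (cball 0 R) x * norm (truncate N (G x) - G x) powr p)"
    "(LINT x|lborel. indicator (cball 0 R) x * norm (truncate N (G x) - G x) powr p) < \<eta>'"
    using truncate_approx[OF G \<open>0 < p\<close> \<open>\<eta>' > 0\<close>, of R] by blast
  note [measurable] = measurable_truncate[OF N(1)]
  obtain g where g: "continuous_on UNIV g"
    "integrable lborel (\<lambda>x. indicator (cball 0 R) x * norm (g x - truncate N (G x)) powr p)"
    "(LINT x|lborel. indicator (cball 0 R) x * norm (g x - truncate N (G x)) powr p) < \<eta>'"
    using bounded_approx[of "\<lambda>x. truncate N (G x)" N p \<eta>' R] norm_truncate_le[OF N(1)] N(1) \<open>0 < p\<close> \<open>\<eta>' > 0\<close>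
    by auto
  let ?F = "\<lambda>x. 2 powr p * (indicator (cball 0 R) x * norm (g x - truncate N (G x)) powr p
       + indicator (cball 0 R) x * norm (truncate N (G x) - G x) powr p)"
  have "(\<integral>\<^sup>+x. ennreal (indicator (cball 0 R) x * norm (g x - G x) powr p) \<partial>lborel)
      \<le> (\<integral>\<^sup>+x. ennreal (?F x) \<partial>lborel)"
  proof (intro nn_integral_mono ennreal_leI)
    fix x
    have "norm (g x - G x) powr p \<le> (norm (g x - truncate N (G x)) + norm (truncate N (G x) - G x)) powr p"
      using \<open>0 < p\<close> norm_triangle_ineq[of "g x - truncate N (G x)" "truncate N (G x) - G x"]
      by (intro powr_mono2) auto
    also have "\<dots> \<le> 2 powr p * (norm (g x - truncate N (G x)) powr p + norm (truncate N (G x) - G x) powr p)"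
      using \<open>0 < p\<close> by (intro powr_add_le) auto
    finally show "indicator (cball 0 R) x * norm (g x - G x) powr p \<le> ?F x"
      by (auto simp: indicator_def)
  qed
  also have "\<dots> = ennreal (LINT x|lborel. ?F x)"
    using N(2) g(2) by (intro nn_integral_eq_integral) auto
  also have "\<dots> \<le> ennreal \<eta>"
  proof (rule ennreal_leI)
    have "(LINT x|lborel. ?F x) \<le> 2 powr p * (\<eta>' + \<eta>')"
      using N g by (simp add: Bochner_Integration.integral_add)
    then show "(LINT x|lborel. ?F x) \<le> \<eta>" by (simp add: \<eta>'_def)
  qed
  finally show ?thesis using g(1) by blast
qed

section \<open>Continuity of translations in local L^p\<close>

lemma nn_integral_lborel_translation:
  fixes f :: "'a::euclidean_space \<Rightarrow> ennreal"
  assumes "f \<in> borel_measurable borel"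
  shows "(\<integral>\<^sup>+z. f (c + z) \<partial>lborel) = (\<integral>\<^sup>+z. f z \<partial>lborel)"
proof -
  have "(\<integral>\<^sup>+z. f z \<partial>distr lborel borel ((+) c)) = (\<integral>\<^sup>+z. f (c + z) \<partial>lborel)"
    by (rule nn_integral_distr) (use assms in auto)
  then show ?thesis unfolding lborel_distr_plus by (rule sym)
qed

text \<open>\<open>G\<close> is compared with a continuous \<open>g\<close>, whose translates are
  uniformly close to it. The shifted error \<open>g (x + z) - G (x + z)\<close> costs no more than
  the unshifted one by translation invariance, at the price of enlarging the radius to
  \<open>R + 1\<close>.\<close>

lemma Lp_translation_continuous:
  fixes G :: "'a::euclidean_space \<Rightarrow> 'b::euclidean_space"
  assumes G: "Lp_borel p G" and "0 < p" "0 < \<eta>"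
  shows "\<exists>d>0. d \<le> 1 \<and> (\<forall>z. norm z \<le> d \<longrightarrow>
    (\<integral>\<^sup>+x. ennreal (indicator (cball 0 R) x * norm (G (x + z) - G x) powr p) \<partial>lborel) \<le> ennreal \<eta>)"
proof -
  have [measurable]: "G \<in> borel_measurable borel" using G by (simp add: Lp_borel_def)
  \<comment> \<open>One factor \<open>2 powr p\<close> for each of the two nested sums split by
    \<open>powr_add_le\<close>.\<close>
  define C where "C = (2 powr p * 2 powr p :: real)"
  have "C > 0" by (simp add: C_def)
  define \<eta>' where "\<eta>' = \<eta> / (3 * C)"
  have "\<eta>' > 0" using assms \<open>C > 0\<close> by (simp add: \<eta>'_def)
  obtain g where g: "continuous_on UNIV g"
    "(\<integral>\<^sup>+x. ennreal (indicator (cball 0 (R + 1)) x * norm (g x - G x) powr p) \<partial>lborel) \<le> ennreal \<eta>'"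
    using Lp_continuous_approx[OF G \<open>0 < p\<close> \<open>\<eta>' > 0\<close>, of "R + 1"] by blast
  note [measurable] = borel_measurable_continuous_onI[OF g(1)]
  define V where "V = measure lborel (cball (0::'a) R)"
  have V: "V \<ge> 0" "emeasure lborel (cball (0::'a) R) = ennreal V"
    using emeasure_lborel_cball_finite[of "0::'a" R] by (auto simp: V_def emeasure_eq_ennreal_measure)
  \<comment> \<open>Chosen so that \<open>V * \<delta> powr p \<le> \<eta>'\<close>; the summand 1
    avoids division by zero when the ball is null.\<close>
  define \<delta> where "\<delta> = (\<eta>' / (V + 1)) powr (1 / p)"
  have "\<delta> > 0" using \<open>\<eta>' > 0\<close> V by (simp add: \<delta>_def)
  obtain d where d: "d > 0" "d \<le> 1" "\<And>x z. norm x \<le> R \<Longrightarrow> norm z \<le> d \<Longrightarrow> norm (g (x + z) - g x) \<le> \<delta>"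
    using uniform_translation[OF g(1) \<open>\<delta> > 0\<close>, of R] by blast
  show ?thesis
  proof (intro exI[of _ d] conjI allI impI)
    fix z :: 'a assume z: "norm z \<le> d"
    define h where "h x = ennreal (indicator (cball 0 (R + 1)) x * norm (g x - G x) powr p)" for x
    have [measurable]: "h \<in> borel_measurable borel"
      unfolding h_def[abs_def] by (intro measurable_compose[OF _ measurable_ennreal] borel_measurable_times
        borel_measurable_indicator powr_real_measurable borel_measurable_norm borel_measurable_diff) auto
    define b :: "'a \<Rightarrow> ennreal" where "b x = indicator (cball 0 R) x * ennreal (\<delta> powr p)" for x
    have [measurable]: "b \<in> borel_measurable borel"
      unfolding b_def[abs_def] by (intro borel_measurable_times_ennreal borel_measurable_indicator) auto
    have "(\<integral>\<^sup>+x. ennreal (indicator (cball 0 R) x * norm (G (x + z) - G x) powr p) \<partial>lborel)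
      \<le> (\<integral>\<^sup>+x. ennreal C * (h (z + x) + h x + b x) \<partial>lborel)"
    proof (rule nn_integral_mono)
      fix x :: 'a
      show "ennreal (indicator (cball 0 R) x * norm (G (x + z) - G x) powr p) \<le>
         ennreal C * (h (z + x) + h x + b x)"
      proof (cases "norm x \<le> R")
        case True
        define A where "A = norm (g (x + z) - G (x + z))"
        define B where "B = norm (g x - G x)"
        define D where "D = norm (g (x + z) - g x)"
        have xz: "norm (z + x) \<le> R + 1" using True z d norm_triangle_ineq[of z x] by linarith
        have D: "D \<le> \<delta>" using d(3)[OF True z] by (simp add: D_def)
        have nn: "0 \<le> A" "0 \<le> B" "0 \<le> D" by (auto simp: A_def B_def D_def)
        have "G (x + z) - G x = (g (x + z) - g x) + (g x - G x) - (g (x + z) - G (x + z))" by simp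
        then have "norm (G (x + z) - G x) \<le> A + (B + D)"
          using norm_triangle_ineq4[of "(g (x + z) - g x) + (g x - G x)" "g (x + z) - G (x + z)"]
            norm_triangle_ineq[of "g (x + z) - g x" "g x - G x"]
          unfolding A_def B_def D_def by simp
        then have "norm (G (x + z) - G x) powr p \<le> (A + (B + D)) powr p"
          using \<open>0 < p\<close> nn by (intro powr_mono2) auto
        also have "\<dots> \<le> 2 powr p * (A powr p + (B + D) powr p)"
          using \<open>0 < p\<close> nn by (intro powr_add_le) auto
        also have "\<dots> \<le> 2 powr p * (2 powr p * A powr p + 2 powr p * (B powr p + D powr p))"
          using \<open>0 < p\<close> nn by (intro mult_left_mono add_mono powr_add_le)
            (auto simp: ge_one_powr_ge_zero mult_le_cancel_right1)
        also have "\<dots> \<le> C * (A powr p + B powr p + \<delta> powr p)"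
          using D nn \<open>0 < p\<close> unfolding C_def
          by (simp add: distrib_left[symmetric] powr_mono2 mult_left_mono mult.assoc)
        finally have "norm (G (x + z) - G x) powr p \<le> C * (A powr p + B powr p + \<delta> powr p)" .
        then have "ennreal (norm (G (x + z) - G x) powr p) \<le> ennreal (C * (A powr p + B powr p + \<delta> powr p))"
          by (rule ennreal_leI)
        also have "\<dots> = ennreal C * (ennreal (A powr p) + ennreal (B powr p) + ennreal (\<delta> powr p))"
          using \<open>C > 0\<close> by (simp add: ennreal_mult)
        finally show ?thesis using True xz by (simp add: h_def b_def A_def B_def add.commute)
      qed simp
    qed
    also have "\<dots> = ennreal C * ((\<integral>\<^sup>+x. h (z + x) \<partial>lborel) + (\<integral>\<^sup>+x. h x \<partial>lborel)
       + (\<integral>\<^sup>+x. b x \<partial>lborel))"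
      by (simp add: nn_integral_cmult nn_integral_add)
    also have "(\<integral>\<^sup>+x. h (z + x) \<partial>lborel) = (\<integral>\<^sup>+x. h x \<partial>lborel)"
      by (rule nn_integral_lborel_translation) measurable
    also have "(\<integral>\<^sup>+x. b x \<partial>lborel) = ennreal (V * \<delta> powr p)"
      using V unfolding b_def mult.commute[of "indicator _ _"]
      by (subst nn_integral_cmult_indicator) (auto simp: ennreal_mult mult.commute)
    also have "ennreal C * ((\<integral>\<^sup>+x. h x \<partial>lborel) + (\<integral>\<^sup>+x. h x \<partial>lborel) + ennreal (V * \<delta> powr p))
      \<le> ennreal C * (ennreal \<eta>' + ennreal \<eta>' + ennreal \<eta>')"
    proof (intro mult_left_mono add_mono g(2)[folded h_def] ennreal_leI)
      have "\<delta> powr p = \<eta>' / (V + 1)" using \<open>0 < p\<close> \<open>\<eta>' > 0\<close> V by (simp add: \<delta>_def powr_powr)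
      then have "\<delta> powr p + V * \<delta> powr p = \<eta>'" using V by (simp add: field_simps)
      then show "V * \<delta> powr p \<le> \<eta>'" using powr_ge_zero[of \<delta> p] by linarith
    qed simp
    also have "\<dots> = ennreal (C * (\<eta>' + \<eta>' + \<eta>'))"
      using \<open>C > 0\<close> \<open>\<eta>' > 0\<close> by (subst ennreal_mult) (auto simp flip: ennreal_plus)
    also have "C * (\<eta>' + \<eta>' + \<eta>') = \<eta>" using \<open>C > 0\<close> by (simp add: \<eta>'_def)
    finally show "(\<integral>\<^sup>+x. ennreal (indicator (cball 0 R) x * norm (G (x + z) - G x) powr p) \<partial>lborel) \<le> ennreal \<eta>" .
  qed (use d in auto)
qed

section \<open>Convergence of mollifications of locally p-integrable functions\<close>

lemma Lp_borel_measurable: "Lp_borel p G \<Longrightarrow> G \<in> borel_measurable borel"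
  by (simp add: Lp_borel_def)

text \<open>On a bounded set the inequality \<open>y powr s \<le> 1 + y powr p\<close> dominates
  every lower power.\<close>

lemma Lp_borel_integrable_powr:
  assumes G: "Lp_borel p G" and "0 \<le> s" "s \<le> p"
  shows "integrable lborel (\<lambda>x. indicator (cball 0 R) x * norm (G x) powr s)"
proof (rule Bochner_Integration.integrable_bound)
  show "integrable lborel (\<lambda>x. indicator (cball 0 R) x *\<^sub>R 1 + indicator (cball 0 R) x * norm (G x) powr p)"
    using G by (intro Bochner_Integration.integrable_add borel_integrable_compact) (auto simp: Lp_borel_def)
  have [measurable]: "G \<in> borel_measurable borel" using G by (rule Lp_borel_measurable)
  show "(\<lambda>x. indicator (cball 0 R) x * norm (G x) powr s) \<in> borel_measurable lborel"
    by (intro borel_measurable_times borel_measurable_indicator powr_real_measurable) auto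
  have "y powr s \<le> 1 + y powr p" if "0 \<le> y" for y :: real
  proof (cases "y \<le> 1")
    case True
    then have "y powr s \<le> 1" using that assms powr_mono2[of s y 1] by simp
    then show ?thesis by (simp add: add_increasing2)
  next
    case False
    then show ?thesis using powr_mono[of s p y] assms by (simp add: add_increasing)
  qed
  then show "AE x in lborel. norm (indicator (cball 0 R) x * norm (G x) powr s) \<le>
     norm (indicator (cball 0 R) x *\<^sub>R 1 + indicator (cball 0 R) x * norm (G x) powr p)"
    by (intro AE_I2) (auto simp: indicator_def)
qed

lemma Lp_borel_integrable_mult:
  fixes w :: "'a::euclidean_space \<Rightarrow> real" and G :: "'a \<Rightarrow> 'b::euclidean_space"
  assumes G: "Lp_borel p G" and "1 \<le> p" and w: "continuous_on UNIV w" "\<And>x. r \<le> norm x \<Longrightarrow> w x = 0"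
  shows "integrable lborel (\<lambda>x. w x *\<^sub>R G x)"
proof -
  have [measurable]: "G \<in> borel_measurable borel" "w \<in> borel_measurable borel"
    using G w borel_measurable_continuous_onI Lp_borel_measurable by auto
  obtain B where B: "\<And>x. x \<in> cball 0 r \<Longrightarrow> norm (w x) \<le> B"
  proof -
    have "bounded (w ` cball 0 r)"
      by (intro compact_imp_bounded compact_continuous_image) (auto intro: continuous_on_subset[OF w(1)])
    then show ?thesis using that unfolding bounded_iff by (metis imageI)
  qed
  have "integrable lborel (\<lambda>x. B * (indicator (cball 0 r) x * norm (G x) powr 1))"
    using \<open>1 \<le> p\<close> by (intro integrable_mult_right Lp_borel_integrable_powr[OF G]) auto
  then show ?thesis
  proof (rule Bochner_Integration.integrable_bound)
    show "(\<lambda>x. w x *\<^sub>R G x) \<in> borel_measurable lborel" by measurable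
    show "AE x in lborel. norm (w x *\<^sub>R G x) \<le> norm (B * (indicator (cball 0 r) x * norm (G x) powr 1))"
    proof (rule AE_I2)
      fix x
      show "norm (w x *\<^sub>R G x) \<le> norm (B * (indicator (cball 0 r) x * norm (G x) powr 1))"
      proof (cases "x \<in> cball 0 r")
        case True
        then have "norm (w x) \<le> \<bar>B\<bar>" using B[OF True] by linarith
        then show ?thesis using True by (simp add: abs_mult mult_right_mono)
      next
        case False
        then show ?thesis using w(2)[of x] by simp
      qed
    qed
  qed
qed

text \<open>Stated with the nonnegative integral so that the later exchange of integrals requires no
  integrability check.\<close>

lemma norm_mollify_diff_le:
  fixes G :: "'a::euclidean_space \<Rightarrow> 'b::euclidean_space"
  assumes G: "Lp_borel p G" and "1 \<le> p" and \<rho>: "mollifier e \<rho>"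
  shows "ennreal (norm (mollify \<rho> G x - G x)) \<le> (\<integral>\<^sup>+z. ennreal (\<rho> z * norm (G (x + z) - G x)) \<partial>lborel)"
proof -
  note \<rho>' = mollifierD[OF \<rho>]
  have [measurable]: "G \<in> borel_measurable borel" "\<rho> \<in> borel_measurable borel"
    using G \<rho>' borel_measurable_continuous_onI Lp_borel_measurable by auto
  have "integrable lborel (\<lambda>y. \<rho> (y - x) *\<^sub>R G y)"
  proof (rule Lp_borel_integrable_mult[OF G \<open>1 \<le> p\<close>, of _ "norm x + e"])
    show "continuous_on UNIV (\<lambda>y. \<rho> (y - x))"
      by (rule continuous_on_compose2[OF \<rho>'(5)]) (auto intro!: continuous_intros)
    show "\<rho> (y - x) = 0" if "norm x + e \<le> norm y" for y
      using that norm_triangle_ineq2[of y x] by (intro \<rho>'(3)) simp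
  qed
  then have "integrable (distr lborel borel ((+) x)) (\<lambda>y. \<rho> (y - x) *\<^sub>R G y)"
    by (simp add: lborel_distr_plus)
  then have i: "integrable lborel (\<lambda>z. \<rho> z *\<^sub>R G (x + z))"
    by (subst (asm) integrable_distr_eq) auto
  have "G x = (LINT z|lborel. \<rho> z *\<^sub>R G x)" using \<rho>' by simp
  then have "mollify \<rho> G x - G x = (LINT z|lborel. \<rho> z *\<^sub>R G (x + z) - \<rho> z *\<^sub>R G x)"
    unfolding mollify_def using \<rho>' by (subst Bochner_Integration.integral_diff) (auto intro: i)
  also have "ennreal (norm \<dots>) \<le> (\<integral>\<^sup>+z. norm (\<rho> z *\<^sub>R G (x + z) - \<rho> z *\<^sub>R G x) \<partial>lborel)"
    by (rule integral_norm_bound_ennreal) (use i \<rho>' in auto)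
  also have "\<dots> = (\<integral>\<^sup>+z. ennreal (\<rho> z * norm (G (x + z) - G x)) \<partial>lborel)"
    using \<rho>'(2) by (intro nn_integral_cong) (simp flip: scaleR_diff_right)
  finally show ?thesis .
qed

text \<open>A weighted Young inequality with crude constants: according to which of \<open>d\<close>
  and \<open>\<tau> * g\<close> is larger, replacing one factor turns the product into one of the
  two terms on the right.\<close>

lemma powr_mult_le_split:
  fixes g d \<tau> p :: real
  assumes "0 \<le> g" "0 \<le> d" "0 < \<tau>" "1 < p"
  shows "g powr (p - 1) * d \<le> \<tau> * g powr p + \<tau> powr (1 - p) * d powr p"
proof (cases "d \<le> \<tau> * g")
  case True
  have "g powr (p - 1) * d \<le> g powr (p - 1) * (\<tau> * g)"
    using True by (intro mult_left_mono) auto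
  also have "\<dots> = \<tau> * g powr p"
    using assms by (cases "g = 0") (auto simp: powr_diff)
  finally show ?thesis by (simp add: add_increasing2)
next
  case False
  then have "d > 0" using assms by (meson le_less_trans mult_nonneg_nonneg not_le less_imp_le)
  have "g \<le> d / \<tau>" using False assms by (simp add: field_simps)
  then have "g powr (p - 1) * d \<le> (d / \<tau>) powr (p - 1) * d"
    using assms by (intro mult_right_mono powr_mono2) auto
  also have "\<dots> = \<tau> powr (1 - p) * d powr p"
    using \<open>d > 0\<close> assms by (simp add: powr_divide powr_diff field_simps)
  finally show ?thesis using assms by (simp add: add_increasing)
qed

text \<open>Strong convergence of mollified gradients is only needed tested against
  \<open>|G|\<^sup>p\<^sup>-\<^sup>1\<close>, so Tonelli reduces it to continuity of translations.\<close>

lemma mollify_converges: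
  fixes G :: "'a::euclidean_space \<Rightarrow> 'b::euclidean_space"
  assumes G: "Lp_borel p G" and "1 < p" "0 < \<eta>"
  shows "\<exists>d>0. d \<le> 1 \<and> (\<forall>e \<rho>. e \<le> d \<longrightarrow> mollifier e \<rho> \<longrightarrow>
    (\<integral>\<^sup>+x. ennreal (indicator (cball 0 R) x * (norm (G x) powr (p - 1) * norm (mollify \<rho> G x - G x))) \<partial>lborel)
      \<le> ennreal \<eta>)"
proof -
  have [measurable]: "G \<in> borel_measurable borel" using G by (rule Lp_borel_measurable)
  have [measurable]: "cball (0::'a) R \<in> sets borel" by simp
  define i :: "'a \<Rightarrow> real" where "i = indicator (cball 0 R)"
  have [measurable]: "i \<in> borel_measurable borel" unfolding i_def by simp
  have i0: "0 \<le> i x" for x by (simp add: i_def)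
  define M where "M = (LINT x|lborel. i x * norm (G x) powr p)"
  have intM: "integrable lborel (\<lambda>x. i x * norm (G x) powr p)"
    using G by (simp add: i_def Lp_borel_def)
  have "M \<ge> 0" unfolding M_def using i0 by simp
  \<comment> \<open>Makes the term with \<open>norm (G x) powr p\<close> at most
    \<open>\<eta> / 2\<close>; the translation error, weighted by \<open>C\<close>, receives the
    other half.\<close>
  define \<tau> where "\<tau> = \<eta> / (2 * (M + 1))"
  have "\<tau> > 0" using \<open>M \<ge> 0\<close> \<open>0 < \<eta>\<close> by (simp add: \<tau>_def)
  define C where "C = \<tau> powr (1 - p)"
  have "C > 0" using \<open>\<tau> > 0\<close> by (simp add: C_def)
  have "\<eta> / (2 * C) > 0" using \<open>C > 0\<close> \<open>0 < \<eta>\<close> by simp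
  then obtain d where d: "d > 0" "d \<le> 1" and T: "\<And>z. norm z \<le> d \<Longrightarrow>
      (\<integral>\<^sup>+x. ennreal (i x * norm (G (x + z) - G x) powr p) \<partial>lborel) \<le> ennreal (\<eta> / (2 * C))"
    using Lp_translation_continuous[OF G, of "\<eta> / (2 * C)" R] \<open>1 < p\<close> unfolding i_def by force
  show ?thesis
  proof (intro exI[of _ d] conjI allI impI)
    fix e and \<rho> :: "'a \<Rightarrow> real" assume e: "e \<le> d" and \<rho>: "mollifier e \<rho>"
    note \<rho>' = mollifierD[OF \<rho>]
    have [measurable]: "\<rho> \<in> borel_measurable borel"
      using \<rho>' borel_measurable_continuous_onI by auto
    define K where "K x z = i x * (norm (G x) powr (p - 1) * norm (G (x + z) - G x))" for x z
    have [measurable]: "(\<lambda>(x, z). K x z) \<in> borel_measurable (borel \<Otimes>\<^sub>M borel)"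
      unfolding K_def by measurable
    have K0: "0 \<le> K x z" for x z using i0 by (simp add: K_def)
    have "(\<integral>\<^sup>+x. ennreal (i x * (norm (G x) powr (p - 1) * norm (mollify \<rho> G x - G x))) \<partial>lborel)
       \<le> (\<integral>\<^sup>+x. (\<integral>\<^sup>+z. ennreal (\<rho> z * K x z) \<partial>lborel) \<partial>lborel)"
    proof (rule nn_integral_mono)
      fix x
      have "ennreal (i x * (norm (G x) powr (p - 1) * norm (mollify \<rho> G x - G x)))
        = ennreal (i x * norm (G x) powr (p - 1)) * ennreal (norm (mollify \<rho> G x - G x))"
        using i0 by (simp add: ennreal_mult[symmetric] mult.assoc)
      also have "\<dots> \<le> ennreal (i x * norm (G x) powr (p - 1)) * (\<integral>\<^sup>+z. ennreal (\<rho> z * norm (G (x + z) - G x)) \<partial>lborel)"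
        using \<open>1 < p\<close> by (intro mult_left_mono norm_mollify_diff_le[OF G _ \<rho>]) auto
      also have "\<dots> = (\<integral>\<^sup>+z. ennreal (\<rho> z * K x z) \<partial>lborel)"
        using i0 \<rho>'(2)
        by (subst nn_integral_cmult[symmetric])
          (auto intro!: nn_integral_cong simp: K_def ennreal_mult[symmetric] mult_ac)
      finally show "ennreal (i x * (norm (G x) powr (p - 1) * norm (mollify \<rho> G x - G x)))
        \<le> (\<integral>\<^sup>+z. ennreal (\<rho> z * K x z) \<partial>lborel)" .
    qed
    \<comment> \<open>With the integrals exchanged, each \<open>z\<close> in the support of the
      kernel is estimated by a single translation of \<open>G\<close>, and the kernel has total mass
      1.\<close>
    also have "\<dots> = (\<integral>\<^sup>+z. (\<integral>\<^sup>+x. ennreal (\<rho> z * K x z) \<partial>lborel) \<partial>lborel)"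
      by (rule lborel_pair.Fubini'[symmetric]) measurable
    also have "\<dots> \<le> (\<integral>\<^sup>+z. ennreal (\<rho> z) * ennreal \<eta> \<partial>lborel)"
    proof (rule nn_integral_mono)
      fix z
      show "(\<integral>\<^sup>+x. ennreal (\<rho> z * K x z) \<partial>lborel) \<le> ennreal (\<rho> z) * ennreal \<eta>"
      proof (cases "norm z \<le> d")
        case True
        have "(\<integral>\<^sup>+x. ennreal (K x z) \<partial>lborel) \<le> (\<integral>\<^sup>+x. ennreal \<tau> * ennreal (i x * norm (G x) powr p)
            + ennreal C * ennreal (i x * norm (G (x + z) - G x) powr p) \<partial>lborel)"
        proof (rule nn_integral_mono)
          fix x
          have "K x z \<le> i x * (\<tau> * norm (G x) powr p + C * norm (G (x + z) - G x) powr p)"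
            unfolding K_def C_def using \<open>\<tau> > 0\<close> \<open>1 < p\<close> i0
            by (intro mult_left_mono powr_mult_le_split) auto
          then have "ennreal (K x z) \<le> ennreal (\<tau> * (i x * norm (G x) powr p) + C * (i x * norm (G (x + z) - G x) powr p))"
            by (intro ennreal_leI) (simp add: algebra_simps)
          then show "ennreal (K x z) \<le> ennreal \<tau> * ennreal (i x * norm (G x) powr p)
            + ennreal C * ennreal (i x * norm (G (x + z) - G x) powr p)"
            using \<open>\<tau> > 0\<close> \<open>C > 0\<close> i0 by (simp add: ennreal_mult)
        qed
        also have "\<dots> = ennreal \<tau> * (\<integral>\<^sup>+x. ennreal (i x * norm (G x) powr p) \<partial>lborel)
            + ennreal C * (\<integral>\<^sup>+x. ennreal (i x * norm (G (x + z) - G x) powr p) \<partial>lborel)"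
          by (simp add: nn_integral_add nn_integral_cmult)
        also have "\<dots> \<le> ennreal \<tau> * ennreal M + ennreal C * ennreal (\<eta> / (2 * C))"
        proof (intro add_mono mult_left_mono T True)
          show "(\<integral>\<^sup>+x. ennreal (i x * norm (G x) powr p) \<partial>lborel) \<le> ennreal M"
            unfolding M_def using intM i0 by (subst nn_integral_eq_integral) auto
        qed auto
        also have "\<dots> = ennreal (\<tau> * M + \<eta> / 2)"
          using \<open>\<tau> > 0\<close> \<open>C > 0\<close> \<open>0 < \<eta>\<close> \<open>M \<ge> 0\<close> by (simp add: ennreal_mult[symmetric] ennreal_plus[symmetric] del: ennreal_plus)
        also have "\<dots> \<le> ennreal \<eta>"
          using \<open>0 < \<eta>\<close> \<open>M \<ge> 0\<close> by (intro ennreal_leI) (simp add: \<tau>_def field_simps)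
        finally have "ennreal (\<rho> z) * (\<integral>\<^sup>+x. ennreal (K x z) \<partial>lborel) \<le> ennreal (\<rho> z) * ennreal \<eta>"
          by (rule mult_left_mono) simp
        then show ?thesis
          using \<rho>'(2) K0 by (simp add: ennreal_mult nn_integral_cmult)
      next
        case False
        then have "\<rho> z = 0" using \<rho>'(3) e by simp
        then show ?thesis by simp
      qed
    qed
    also have "\<dots> = ennreal \<eta>"
      using \<rho>' by (simp add: nn_integral_multc nn_integral_eq_integral)
    finally show "(\<integral>\<^sup>+x. ennreal (indicator (cball 0 R) x * (norm (G x) powr (p - 1) * norm (mollify \<rho> G x - G x))) \<partial>lborel)
      \<le> ennreal \<eta>" by (simp add: i_def)
  qed (use d in auto)
qed

text \<open>For fixed \<open>x\<close> the translated kernel \<open>\<rho> (y - x)\<close> is a test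
  function of \<open>y\<close>. Inserting it into the defining identity of the weak gradient moves
  the derivative from the kernel onto \<open>u\<close>.\<close>

lemma grad_mollify_weak_gradient:
  fixes u :: "'a::euclidean_space \<Rightarrow> real"
  assumes u: "continuous_on UNIV u" and G: "Lp_borel p G" "1 \<le> p"
    and weak: "is_weak_gradient u G" and \<rho>: "mollifier e \<rho>"
  shows "(mollify \<rho> u has_derivative (\<lambda>v. mollify \<rho> G x \<bullet> v)) (at x)"
    and "continuous_on UNIV (mollify \<rho> G)"
proof -
  note \<rho>' = mollifierD[OF \<rho>]
  note der = mollify_has_derivative_left[OF u \<rho>'(1,3)]
  have eq: "(LINT y|lborel. - u y *\<^sub>R grad \<rho> (y - x)) = mollify \<rho> G x" for x
  proof (rule euclidean_eqI)
    fix b :: 'a assume b: "b \<in> Basis"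
    define \<phi> where "\<phi> y = \<rho> (y - x)" for y
    have out: "e \<le> norm (y - x)" if "norm x + e \<le> norm y" for y
      using that norm_triangle_ineq2[of y x] by simp
    have sm: "smooth \<phi>" using \<rho>'(1) by (simp add: smooth_def \<phi>_def[abs_def] Ck_on_translation)
    have z: "\<phi> y = 0" if "norm x + e \<le> norm y" for y
      using \<rho>'(3) out[OF that] by (simp add: \<phi>_def)
    have gr: "grad \<phi> y = grad \<rho> (y - x)" for y
    proof (rule grad_eqI)
      show "(\<phi> has_derivative (\<lambda>v. grad \<rho> (y - x) \<bullet> v)) (at y)"
        unfolding \<phi>_def[abs_def]
        by (rule has_derivative_compose[where f="\<lambda>y. y - x" and f'="\<lambda>v. v",
              OF _ has_derivative_grad[OF smooth_differentiable[OF \<rho>'(1)]]])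
          (auto intro!: derivative_eq_intros)
    qed
    have cg: "continuous_on UNIV (grad \<phi>)" by (rule continuous_on_smooth_grad[OF sm])
    have gz: "grad \<phi> y = 0" if "norm x + e \<le> norm y" for y
      by (rule grad_zero_outside[OF z sm that])
    have i1: "integrable lborel (\<lambda>y. - u y *\<^sub>R grad \<phi> y)"
      by (rule integrable_continuous_bounded_support[where r="norm x + e"])
        (auto intro!: continuous_intros u cg simp: gz)
    have i2: "integrable lborel (\<lambda>y. \<phi> y *\<^sub>R G y)"
      by (rule Lp_borel_integrable_mult[OF G smooth_continuous[OF sm]]) (rule z)
    have [measurable]: "G \<in> borel_measurable borel" "u \<in> borel_measurable borel"
      "\<phi> \<in> borel_measurable borel" "grad \<phi> \<in> borel_measurable borel"
      using G u cg smooth_continuous[OF sm] borel_measurable_continuous_onI Lp_borel_measurable by auto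
    have "(LINT y|lborel. - u y *\<^sub>R grad \<rho> (y - x)) \<bullet> b = (LINT y|lborel. (- u y *\<^sub>R grad \<phi> y) \<bullet> b)"
      using i1 by (simp only: integral_inner_left gr)
    also have "\<dots> = - (LINT y|lborel. u y * (grad \<phi> y \<bullet> b))" by simp
    also have "\<dots> = - (LINT y|lebesgue. u y * (grad \<phi> y \<bullet> b))"
      by (subst integral_completion) auto
    also have "\<dots> = (LINT y|lebesgue. (G y \<bullet> b) * \<phi> y)"
      using weak test_functionsI[OF sm z] b unfolding is_weak_gradient_def by simp
    also have "\<dots> = (LINT y|lborel. (G y \<bullet> b) * \<phi> y)"
      by (subst integral_completion) auto
    also have "\<dots> = (LINT y|lborel. (\<phi> y *\<^sub>R G y) \<bullet> b)" by (simp add: mult.commute)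
    also have "\<dots> = (LINT y|lborel. \<phi> y *\<^sub>R G y) \<bullet> b"
      using i2 by (simp only: integral_inner_left)
    also have "(LINT y|lborel. \<phi> y *\<^sub>R G y) = mollify \<rho> G x"
      using mollify_eq[OF _ \<rho>'(5), of G x] by (simp add: \<phi>_def)
    finally show "(LINT y|lborel. - u y *\<^sub>R grad \<rho> (y - x)) \<bullet> b = mollify \<rho> G x \<bullet> b" .
  qed
  show der': "(mollify \<rho> u has_derivative (\<lambda>v. mollify \<rho> G x \<bullet> v)) (at x)" for x
    using der unfolding eq .
  \<comment> \<open>The mollified \<open>G\<close> is the gradient of a smooth function, hence
    continuous although \<open>G\<close> is not.\<close>
  have "grad (mollify \<rho> u) = mollify \<rho> G"
    using grad_eqI[OF der'] by blast
  then show "continuous_on UNIV (mollify \<rho> G)"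
    using continuous_on_smooth_grad[OF smooth_mollify[OF u \<rho>'(1,3)]] by simp
qed

section \<open>The anisotropic field\<close>

lemma admissible_anisotropyD:
  fixes H :: "'a::euclidean_space \<Rightarrow> real"
  assumes "admissible_anisotropy H"
  shows "\<And>\<xi>. \<xi> \<noteq> 0 \<Longrightarrow> H differentiable (at \<xi>)" "continuous_on (- {0}) (grad H)"
    "continuous_on UNIV H" "\<And>t \<xi>. 0 < t \<Longrightarrow> H (t *\<^sub>R \<xi>) = t * H \<xi>" "\<And>\<xi>. \<xi> \<noteq> 0 \<Longrightarrow> 0 < H \<xi>"
proof -
  have C2: "Ck_on (Suc (Suc 0)) (- {0}) H"
    using assms unfolding admissible_anisotropy_def by (simp add: numeral_2_eq_2 del: Ck_on.simps)
  show "H differentiable (at \<xi>)" if "\<xi> \<noteq> 0" for \<xi>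
    using C2 that by simp
  have "continuous_on (- {0}) (\<lambda>x. frechet_derivative H (at x) b)" if "b \<in> Basis" for b
    using C2 that by (auto intro!: continuous_at_imp_continuous_on differentiable_imp_continuous_within)
  then show "continuous_on (- {0}) (grad H)"
    unfolding grad_def[abs_def] by (intro continuous_intros)
  show hom: "H (t *\<^sub>R \<xi>) = t * H \<xi>" if "0 < t" for t \<xi>
    using assms that unfolding admissible_anisotropy_def by auto
  show "continuous_on UNIV H"
    using assms unfolding admissible_anisotropy_def by auto
  show "0 < H \<xi>" if "\<xi> \<noteq> 0" for \<xi>
  proof -
    have "\<forall>\<xi>\<in>sphere 0 1. 0 < H \<xi>"
      using assms unfolding admissible_anisotropy_def by blast
    then have "0 < H (\<xi> /\<^sub>R norm \<xi>)"
      by (rule bspec) (use that in simp)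
    moreover have "H (norm \<xi> *\<^sub>R (\<xi> /\<^sub>R norm \<xi>)) = norm \<xi> * H (\<xi> /\<^sub>R norm \<xi>)"
      using that by (intro hom) simp
    ultimately show ?thesis using that by simp
  qed
qed

text \<open>Differentiate both sides of the scaling identity in \<open>\<xi>\<close> and cancel the
  factor \<open>t\<close>.\<close>

lemma grad_homogeneous:
  fixes H :: "'a::euclidean_space \<Rightarrow> real"
  assumes d: "H differentiable (at \<xi>)" "H differentiable (at (t *\<^sub>R \<xi>))"
    and hom: "\<And>t \<xi>. 0 < t \<Longrightarrow> H (t *\<^sub>R \<xi>) = t * H \<xi>" and "0 < t"
  shows "grad H (t *\<^sub>R \<xi>) = grad H \<xi>"
proof -
  have "((\<lambda>\<xi>. H (t *\<^sub>R \<xi>)) has_derivative (\<lambda>v. grad H (t *\<^sub>R \<xi>) \<bullet> (t *\<^sub>R v))) (at \<xi>)"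
    by (rule has_derivative_compose[where f="\<lambda>\<xi>. t *\<^sub>R \<xi>" and f'="\<lambda>v. t *\<^sub>R v",
          OF _ has_derivative_grad[OF d(2)]]) (auto intro!: derivative_eq_intros)
  then have "((\<lambda>\<xi>. t * H \<xi>) has_derivative (\<lambda>v. (t *\<^sub>R grad H (t *\<^sub>R \<xi>)) \<bullet> v)) (at \<xi>)"
    using hom[OF \<open>0 < t\<close>] by simp
  moreover have "((\<lambda>\<xi>. t * H \<xi>) has_derivative (\<lambda>v. (t *\<^sub>R grad H \<xi>) \<bullet> v)) (at \<xi>)"
    using has_derivative_grad[OF d(1)] by (auto intro!: derivative_eq_intros)
  ultimately have "t *\<^sub>R grad H (t *\<^sub>R \<xi>) = t *\<^sub>R grad H \<xi>"
    using grad_eqI by metis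
  then show ?thesis using \<open>0 < t\<close> by simp
qed

text \<open>Euler's identity, by computing the derivative of \<open>H\<close> along the ray through
  \<open>\<xi>\<close> at parameter 1 in two ways.\<close>

lemma euler_homogeneous:
  fixes H :: "'a::euclidean_space \<Rightarrow> real"
  assumes d: "H differentiable (at \<xi>)" and hom: "\<And>t \<xi>. 0 < t \<Longrightarrow> H (t *\<^sub>R \<xi>) = t * H \<xi>"
  shows "grad H \<xi> \<bullet> \<xi> = H \<xi>"
proof -
  have "((\<lambda>t. H (t *\<^sub>R \<xi>)) has_derivative (\<lambda>s. grad H \<xi> \<bullet> (s *\<^sub>R \<xi>))) (at (1::real))"
    by (rule has_derivative_compose[where f="\<lambda>t. t *\<^sub>R \<xi>" and g=H])
      (use has_derivative_grad[OF d] in \<open>auto intro!: derivative_eq_intros\<close>)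
  moreover have "((\<lambda>t. H (t *\<^sub>R \<xi>)) has_derivative (\<lambda>s. s * H \<xi>)) (at (1::real))"
  proof (rule has_derivative_transform_within_open[where s="{0<..}" and f="\<lambda>t. t * H \<xi>"])
    show "((\<lambda>t. t * H \<xi>) has_derivative (\<lambda>s. s * H \<xi>)) (at (1::real))"
      by (auto intro!: derivative_eq_intros)
  qed (use hom in auto)
  ultimately have "(\<lambda>s. grad H \<xi> \<bullet> (s *\<^sub>R \<xi>)) = (\<lambda>s. s * H \<xi>)"
    by (rule has_derivative_unique)
  then show ?thesis by (metis mult_1 scaleR_one)
qed

lemma aniso_field_eq:
  fixes H :: "'a::euclidean_space \<Rightarrow> real"
  assumes H: "admissible_anisotropy H" and "0 < p" "\<xi> \<noteq> 0"
  shows "aniso_field p H \<xi> = H \<xi> powr (p - 1) *\<^sub>R grad H \<xi>"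
proof -
  note H' = admissible_anisotropyD[OF H]
  have "((\<lambda>\<eta>. H \<eta> powr p) has_derivative (\<lambda>v. ((p * H \<xi> powr (p - 1)) *\<^sub>R grad H \<xi>) \<bullet> v)) (at \<xi>)"
  proof -
    have "((\<lambda>t. t powr p) has_derivative (\<lambda>s. p * H \<xi> powr (p - 1) * s)) (at (H \<xi>))"
      using has_real_derivative_powr[OF H'(5)[OF \<open>\<xi> \<noteq> 0\<close>], of p] by (simp add: has_field_derivative_def)
    from has_derivative_compose[OF has_derivative_grad[OF H'(1)[OF \<open>\<xi> \<noteq> 0\<close>]] this]
    show ?thesis by simp
  qed
  then have "grad (\<lambda>\<eta>. H \<eta> powr p) \<xi> = (p * H \<xi> powr (p - 1)) *\<^sub>R grad H \<xi>"
    by (rule grad_eqI)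
  then show ?thesis using assms by (simp add: aniso_field_def)
qed

text \<open>\<open>H\<close> and the norm of its gradient attain their extrema on the unit sphere,
  and homogeneity of degrees one and zero extends the bounds to all \<open>\<xi>\<close>. For
  coercivity, Euler's identity turns \<open>aniso_field p H \<xi> \<bullet> \<xi>\<close> into
  \<open>H \<xi> powr p\<close>.\<close>

lemma aniso_field_bounds:
  fixes H :: "'a::euclidean_space \<Rightarrow> real"
  assumes H: "admissible_anisotropy H" and "1 < p"
  obtains c C where "0 < c" "0 < C" "\<And>\<xi>. c * norm \<xi> powr p \<le> aniso_field p H \<xi> \<bullet> \<xi>"
    "\<And>\<xi>. norm (aniso_field p H \<xi>) \<le> C * norm \<xi> powr (p - 1)"
proof -
  note H' = admissible_anisotropyD[OF H]
  let ?S = "sphere (0::'a) 1"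
  have ne: "?S \<noteq> {}" by simp
  have cH: "continuous_on ?S H" using H'(3) continuous_on_subset by blast
  obtain x1 where x1: "x1 \<in> ?S" "\<And>y. y \<in> ?S \<Longrightarrow> H x1 \<le> H y"
    using continuous_attains_inf[OF compact_sphere ne cH] by blast
  obtain x2 where x2: "x2 \<in> ?S" "\<And>y. y \<in> ?S \<Longrightarrow> H y \<le> H x2"
    using continuous_attains_sup[OF compact_sphere ne cH] by blast
  have "continuous_on ?S (\<lambda>x. norm (grad H x))"
    by (intro continuous_intros continuous_on_subset[OF H'(2)]) auto
  then obtain x3 where x3: "\<And>y. y \<in> ?S \<Longrightarrow> norm (grad H y) \<le> norm (grad H x3)"
    using continuous_attains_sup[OF compact_sphere ne] by metis
  have "x1 \<noteq> 0" "x2 \<noteq> 0" using x1(1) x2(1) by auto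
  then have pos: "0 < H x1" "0 < H x2" using H'(5) by auto
  have dir: "\<xi> /\<^sub>R norm \<xi> \<in> ?S" "H \<xi> = norm \<xi> * H (\<xi> /\<^sub>R norm \<xi>)" "grad H \<xi> = grad H (\<xi> /\<^sub>R norm \<xi>)"
    if "\<xi> \<noteq> 0" for \<xi>
  proof -
    show "\<xi> /\<^sub>R norm \<xi> \<in> ?S" using that by simp
    show "H \<xi> = norm \<xi> * H (\<xi> /\<^sub>R norm \<xi>)"
      using H'(4)[of "norm \<xi>" "\<xi> /\<^sub>R norm \<xi>"] that by simp
    show "grad H \<xi> = grad H (\<xi> /\<^sub>R norm \<xi>)"
      using that by (intro grad_homogeneous[symmetric] H') auto
  qed
  show ?thesis
  proof
    show "0 < H x1 powr p" using pos by simp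
    \<comment> \<open>The summand 1 makes this constant positive without a lower bound for the
      gradient.\<close>
    show "0 < H x2 powr (p - 1) * (norm (grad H x3) + 1)"
      using pos by (intro mult_pos_pos) (auto intro: add_nonneg_pos)
    fix \<xi> :: 'a
    show "H x1 powr p * norm \<xi> powr p \<le> aniso_field p H \<xi> \<bullet> \<xi>"
    proof (cases "\<xi> = 0")
      case False
      have "H x1 powr p * norm \<xi> powr p = (norm \<xi> * H x1) powr p"
        using pos by (simp add: powr_mult)
      also have "\<dots> \<le> H \<xi> powr p"
        using x1(2)[OF dir(1)[OF False]] dir(2)[OF False] pos \<open>1 < p\<close>
        by (intro powr_mono2) (auto simp: mult_left_mono)
      also have "\<dots> = H \<xi> powr (p - 1) * H \<xi>"
        using H'(5)[OF False] by (simp add: powr_diff)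
      also have "\<dots> = aniso_field p H \<xi> \<bullet> \<xi>"
        using \<open>1 < p\<close> False by (simp add: aniso_field_eq[OF H] euler_homogeneous[OF H'(1,4)])
      finally show ?thesis .
    qed (use \<open>1 < p\<close> in simp)
    show "norm (aniso_field p H \<xi>) \<le> H x2 powr (p - 1) * (norm (grad H x3) + 1) * norm \<xi> powr (p - 1)"
    proof (cases "\<xi> = 0")
      case False
      have "norm (aniso_field p H \<xi>) = H \<xi> powr (p - 1) * norm (grad H \<xi>)"
        using \<open>1 < p\<close> False by (simp add: aniso_field_eq[OF H])
      also have "\<dots> \<le> (norm \<xi> * H x2) powr (p - 1) * (norm (grad H x3) + 1)"
      proof (intro mult_mono powr_mono2)
        show "H \<xi> \<le> norm \<xi> * H x2"
          using x2(2)[OF dir(1)[OF False]] dir(2)[OF False] by (simp add: mult_left_mono)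
        show "norm (grad H \<xi>) \<le> norm (grad H x3) + 1"
          using x3[OF dir(1)[OF False]] dir(3)[OF False] by simp
      qed (use \<open>1 < p\<close> H'(5)[OF False] in auto)
      also have "\<dots> = H x2 powr (p - 1) * (norm (grad H x3) + 1) * norm \<xi> powr (p - 1)"
        using pos by (simp add: powr_mult)
      finally show ?thesis .
    qed (simp add: aniso_field_def)
  qed
qed

lemma measurable_aniso_field:
  fixes H :: "'a::euclidean_space \<Rightarrow> real"
  assumes H: "admissible_anisotropy H" and "1 < p"
  shows "aniso_field p H \<in> borel_measurable borel"
proof -
  note H' = admissible_anisotropyD[OF H]
  have "aniso_field p H = (\<lambda>\<xi>. if \<xi> \<in> {0} then 0 else H \<xi> powr (p - 1) *\<^sub>R grad H \<xi>)"
    using \<open>1 < p\<close> aniso_field_eq[OF H, of p] by (auto simp: aniso_field_def)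
  also have "\<dots> \<in> borel_measurable borel"
  proof (rule borel_measurable_continuous_on_if)
    show "continuous_on (- {0}) (\<lambda>\<xi>. H \<xi> powr (p - 1) *\<^sub>R grad H \<xi>)"
      by (intro continuous_intros H'(2) continuous_on_subset[OF H'(3)])
        (use H'(5) in \<open>auto simp: less_imp_neq[THEN not_sym]\<close>)
  qed auto
  finally show ?thesis .
qed

section \<open>Enlarging the class of test functions\<close>

lemma integrable_inner_bounded_support:
  fixes A D :: "'a::euclidean_space \<Rightarrow> 'b::euclidean_space"
  assumes A: "Lp_borel 1 A" and D: "continuous_on UNIV D" "\<And>x. R \<le> norm x \<Longrightarrow> D x = 0"
  shows "integrable lborel (\<lambda>x. A x \<bullet> D x)"
proof -
  have [measurable]: "A \<in> borel_measurable borel" "D \<in> borel_measurable borel"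
    using A D borel_measurable_continuous_onI by (auto simp: Lp_borel_def)
  have "bounded (D ` cball 0 R)"
    by (intro compact_imp_bounded compact_continuous_image) (auto intro: continuous_on_subset[OF D(1)])
  then obtain B where B: "\<And>x. x \<in> cball 0 R \<Longrightarrow> norm (D x) \<le> B"
    unfolding bounded_iff by (metis imageI)
  have "integrable lborel (\<lambda>x. B * (indicator (cball 0 R) x * norm (A x) powr 1))"
    using A unfolding Lp_borel_def by (intro integrable_mult_right) auto
  then show ?thesis
  proof (rule Bochner_Integration.integrable_bound)
    show "(\<lambda>x. A x \<bullet> D x) \<in> borel_measurable lborel" by measurable
    show "AE x in lborel. norm (A x \<bullet> D x) \<le> norm (B * (indicator (cball 0 R) x * norm (A x) powr 1))"
    proof (rule AE_I2)
      fix x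
      show "norm (A x \<bullet> D x) \<le> norm (B * (indicator (cball 0 R) x * norm (A x) powr 1))"
      proof (cases "x \<in> cball 0 R")
        case True
        have "norm (A x \<bullet> D x) \<le> norm (A x) * norm (D x)" by (simp add: Cauchy_Schwarz_ineq2)
        also have "\<dots> \<le> norm (A x) * \<bar>B\<bar>"
          using B[OF True] by (intro mult_left_mono) auto
        finally show ?thesis using True by (simp add: abs_mult mult.commute)
      qed (use D(2)[of x] in simp)
    qed
  qed
qed

text \<open>\<open>M\<close> may have any sign, so the error terms of the approximations can be
  collected as they come.\<close>

lemma le_if_le_add_mult_eps:
  fixes x y M :: real
  assumes "\<And>e. 0 < e \<Longrightarrow> x \<le> y + e * M"
  shows "x \<le> y"
proof (rule field_le_epsilon)
  fix e :: real assume "0 < e"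
  have "x \<le> y + e / (\<bar>M\<bar> + 1) * M" using \<open>0 < e\<close> by (intro assms) simp
  also have "e / (\<bar>M\<bar> + 1) * M \<le> e / (\<bar>M\<bar> + 1) * (\<bar>M\<bar> + 1)"
    using \<open>0 < e\<close> by (intro mult_left_mono) auto
  finally show "x \<le> y + e" by simp
qed

text \<open>The test function is mollified. Its gradient is continuous with bounded support, so the
  mollified gradients converge uniformly, which suffices against a locally integrable
  \<open>A\<close>. Smoothing widths at most 1 keep all supports inside radius
  \<open>R + 1\<close>.\<close>

lemma weak_inequality_C1_test:
  fixes A D :: "'a::euclidean_space \<Rightarrow> 'a"
  assumes A: "Lp_borel 1 A" and w: "continuous_on UNIV w"
    and ineq: "\<And>\<phi>. \<phi> \<in> test_functions \<Longrightarrow> (\<And>x. 0 \<le> \<phi> x) \<Longrightarrow>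
      (LINT x|lborel. A x \<bullet> grad \<phi> x) \<le> (LINT x|lborel. w x * \<phi> x)"
    and \<phi>: "\<And>x. (\<phi> has_derivative (\<lambda>v. D x \<bullet> v)) (at x)" "continuous_on UNIV D"
      "\<And>x. 0 \<le> \<phi> x" "\<And>x. R \<le> norm x \<Longrightarrow> \<phi> x = 0" "\<And>x. R \<le> norm x \<Longrightarrow> D x = 0"
  shows "(LINT x|lborel. A x \<bullet> D x) \<le> (LINT x|lborel. w x * \<phi> x)"
proof (rule le_if_le_add_mult_eps)
  fix \<eta> :: real assume "0 < \<eta>"
  let ?i = "indicator (cball 0 (R + 1)) :: 'a \<Rightarrow> real"
  have c\<phi>: "continuous_on UNIV \<phi>" by (rule has_derivative_imp_continuous_on_UNIV[OF \<phi>(1)])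
  obtain d1 where d1: "d1 > 0" "d1 \<le> 1"
    "\<And>x z. norm x \<le> R + 1 \<Longrightarrow> norm z \<le> d1 \<Longrightarrow> norm (D (x + z) - D x) \<le> \<eta>"
    using uniform_translation[OF \<phi>(2) \<open>0 < \<eta>\<close>, of "R + 1"] by blast
  obtain d2 where d2: "d2 > 0" "d2 \<le> 1"
    "\<And>x z. norm x \<le> R + 1 \<Longrightarrow> norm z \<le> d2 \<Longrightarrow> norm (\<phi> (x + z) - \<phi> x) \<le> \<eta>"
    using uniform_translation[OF c\<phi> \<open>0 < \<eta>\<close>, of "R + 1"] by blast
  define d where "d = min d1 d2"
  have d: "d > 0" "d \<le> 1" "d \<le> d1" "d \<le> d2" using d1 d2 by (auto simp: d_def)
  obtain \<rho> :: "'a \<Rightarrow> real" where \<rho>: "mollifier d \<rho>" using mollifier_exists[OF d(1)] by blast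
  note \<rho>' = mollifierD[OF \<rho>]
  define \<psi> where "\<psi> = mollify \<rho> \<phi>"
  define E where "E = mollify \<rho> D"
  have sm: "smooth \<psi>" unfolding \<psi>_def by (rule smooth_mollify[OF c\<phi> \<rho>'(1,3)])
  have gr: "grad \<psi> = E"
    using grad_eqI[OF mollify_has_derivative_right[OF \<phi>(1,2) \<rho>'(5,3)]] unfolding \<psi>_def E_def by blast
  have out: "\<psi> x = 0" "E x = 0" "\<phi> x = 0" "D x = 0" if "R + 1 \<le> norm x" for x
    unfolding \<psi>_def E_def using that d \<phi>(4,5) by (auto intro: mollify_zero_outside[OF \<rho>, of R])
  have nn: "0 \<le> \<psi> x" for x
    unfolding \<psi>_def by (rule mollify_lower_bound[OF c\<phi> \<rho>]) (rule \<phi>(3))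
  have cE: "continuous_on UNIV E" using continuous_on_smooth_grad[OF sm] gr by simp
  note c\<psi> = smooth_continuous[OF sm]
  have ED: "norm (E x - D x) \<le> \<eta>" and \<psi>\<phi>: "norm (\<psi> x - \<phi> x) \<le> \<eta>" if "norm x \<le> R + 1" for x
    unfolding E_def \<psi>_def using that d
    by (auto intro!: mollify_dist_le[OF _ \<rho>] c\<phi> \<phi>(2) d1(3) d2(3) simp del: real_norm_def)
  have iA: "integrable lborel (\<lambda>x. ?i x * norm (A x))"
    using A by (simp add: Lp_borel_def)
  have iw: "integrable lborel (\<lambda>x. ?i x *\<^sub>R \<bar>w x\<bar>)"
    by (rule borel_integrable_compact) (auto intro!: continuous_intros continuous_on_subset[OF w])
  have "(LINT x|lborel. A x \<bullet> D x) \<le> (LINT x|lborel. A x \<bullet> E x + \<eta> * (?i x * norm (A x)))"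
  proof (rule integral_mono)
    show "integrable lborel (\<lambda>x. A x \<bullet> D x)"
      by (rule integrable_inner_bounded_support[OF A \<phi>(2,5)])
    show "integrable lborel (\<lambda>x. A x \<bullet> E x + \<eta> * (?i x * norm (A x)))"
      using iA integrable_inner_bounded_support[OF A cE out(2)] by auto
    fix x
    show "A x \<bullet> D x \<le> A x \<bullet> E x + \<eta> * (?i x * norm (A x))"
    proof (cases "norm x \<le> R + 1")
      case True
      have "A x \<bullet> (D x - E x) \<le> norm (A x) * norm (D x - E x)" by (rule norm_cauchy_schwarz)
      also have "\<dots> \<le> norm (A x) * \<eta>"
        using ED[OF True] by (intro mult_left_mono) (auto simp: norm_minus_commute)
      finally show ?thesis using True by (simp add: inner_diff_right mult.commute)
    qed (use out[of x] in simp)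
  qed
  also have "\<dots> = (LINT x|lborel. A x \<bullet> E x) + \<eta> * (LINT x|lborel. ?i x * norm (A x))"
    using iA integrable_inner_bounded_support[OF A cE out(2)] by simp
  also have "(LINT x|lborel. A x \<bullet> E x) \<le> (LINT x|lborel. w x * \<psi> x)"
    using ineq[OF test_functionsI[OF sm out(1)] nn] unfolding gr by simp
  also have "(LINT x|lborel. w x * \<psi> x) \<le> (LINT x|lborel. w x * \<phi> x + \<eta> * (?i x *\<^sub>R \<bar>w x\<bar>))"
  proof (rule integral_mono)
    show "integrable lborel (\<lambda>x. w x * \<psi> x)"
      by (rule integrable_continuous_bounded_support[where r="R + 1"])
        (auto intro!: continuous_intros w c\<psi> simp: out)
    show "integrable lborel (\<lambda>x. w x * \<phi> x + \<eta> * (?i x *\<^sub>R \<bar>w x\<bar>))"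
      by (intro Bochner_Integration.integrable_add integrable_mult_right iw
          integrable_continuous_bounded_support[where r="R + 1"])
        (auto intro!: continuous_intros w c\<phi> simp: out)
    fix x
    show "w x * \<psi> x \<le> w x * \<phi> x + \<eta> * (?i x *\<^sub>R \<bar>w x\<bar>)"
    proof (cases "norm x \<le> R + 1")
      case True
      have "w x * (\<psi> x - \<phi> x) \<le> \<bar>w x\<bar> * \<bar>\<psi> x - \<phi> x\<bar>" by (metis abs_ge_self abs_mult)
      also have "\<dots> \<le> \<bar>w x\<bar> * \<eta>"
        using \<psi>\<phi>[OF True] by (intro mult_left_mono) auto
      finally show ?thesis using True by (simp add: right_diff_distrib mult.commute)
    qed (use out[of x] in simp)
  qed
  also have "\<dots> = (LINT x|lborel. w x * \<phi> x) + \<eta> * (LINT x|lborel. ?i x *\<^sub>R \<bar>w x\<bar>)"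
    using iw by (subst Bochner_Integration.integral_add)
      (auto intro!: continuous_intros w c\<phi> integrable_continuous_bounded_support[where r="R + 1"] simp: out)
  finally show "(LINT x|lborel. A x \<bullet> D x) \<le> (LINT x|lborel. w x * \<phi> x) +
     \<eta> * ((LINT x|lborel. ?i x *\<^sub>R \<bar>w x\<bar>) + (LINT x|lborel. ?i x * norm (A x)))"
    by (simp add: algebra_simps)
qed

section \<open>The Keller--Osserman estimate\<close>

text \<open>\<open>\<Phi> t\<close> is the tail integral of \<open>k\<close> over (t, oo), written
  as \<open>L - W t\<close> with an oriented integral \<open>W\<close> from 1. This covers
  \<open>t < 1\<close> as well, although \<open>k\<close> may fail to be integrable at 0.\<close>

lemma keller_osserman_primitive:
  fixes k :: "real \<Rightarrow> real"
  assumes k: "continuous_on {0<..} k" "\<And>t. 0 < t \<Longrightarrow> 0 < k t" "set_integrable lborel {1..} k"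
  obtains \<Phi> where "\<And>t. 0 < t \<Longrightarrow> 0 < \<Phi> t" "\<And>t. 0 < t \<Longrightarrow> (\<Phi> has_real_derivative - k t) (at t)"
proof -
  define W where "W t = (LBINT y=ereal 1..ereal t. k y)" for t :: real
  have der: "(W has_real_derivative k t) (at t)" if "0 < t" for t
  proof -
    \<comment> \<open>A compact interval in the positive reals with both 1 and \<open>t\<close> in
      its interior, as the fundamental theorem demands.\<close>
    define a b where "a = min 1 t / 2" and "b = max 1 t + 1"
    have ab: "0 < a" "a < 1" "a < t" "1 < b" "t < b" using that by (auto simp: a_def b_def)
    have "((\<lambda>u. LBINT y=ereal 1..ereal u. k y) has_vector_derivative k t) (at t within {a..b})"
      using ab by (intro interval_integral_FTC2 continuous_on_subset[OF k(1)]) auto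
    then have "(W has_real_derivative k t) (at t within {a..b})"
      by (simp add: W_def[abs_def] has_real_derivative_iff_has_vector_derivative)
    then show ?thesis using ab by (simp add: at_within_Icc_at)
  qed
  define L where "L = (LINT y:{1..}|lborel. k y)"
  have bound: "W t \<le> L" if "1 \<le> t" for t
  proof -
    have "W t = (LINT y:{1<..<t}|lborel. k y)"
      using that by (simp add: W_def interval_lebesgue_integral_def einterval_eq)
    also have "\<dots> \<le> L"
      unfolding L_def set_lebesgue_integral_def
    proof (rule integral_mono)
      show "integrable lborel (\<lambda>x. indicator {1..} x *\<^sub>R k x)"
        using k(3) by (simp add: set_integrable_def)
      have "set_integrable lborel {1<..<t} k"
        by (rule set_integrable_subset[OF k(3)]) auto
      then show "integrable lborel (\<lambda>x. indicator {1<..<t} x *\<^sub>R k x)"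
        by (simp add: set_integrable_def)
      show "indicator {1<..<t} x *\<^sub>R k x \<le> indicator {1..} x *\<^sub>R k x" for x
        using k(2)[of x] by (auto simp: indicator_def)
    qed
    finally show ?thesis .
  qed
  \<comment> \<open>Positivity of \<open>\<Phi>\<close> needs the strict bound: \<open>W\<close>
    increases strictly up to a point beyond both 1 and \<open>t\<close>, where the weak bound
    applies.\<close>
  have "W t < L" if "0 < t" for t
  proof -
    have "W t < W (max 1 t + 1)"
    proof (rule DERIV_pos_imp_increasing[where f=W])
      fix x assume "t \<le> x"
      then have "0 < x" using that by simp
      then show "\<exists>y. (W has_real_derivative y) (at x) \<and> 0 < y" using der k(2) by blast
    qed simp
    also have "\<dots> \<le> L" by (rule bound) simp
    finally show ?thesis .
  qed
  then show ?thesis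
    by (intro that[of "\<lambda>t. L - W t"]) (auto intro!: derivative_eq_intros der)
qed

text \<open>Each factor is at most the same power of the largest of the three numbers, and the
  exponents add up to 1.\<close>

lemma young_three:
  fixes a b c \<alpha> \<beta> \<delta> :: real
  assumes "0 \<le> a" "0 \<le> b" "0 \<le> c" "0 < \<alpha>" "0 < \<beta>" "0 < \<delta>" "\<alpha> + \<beta> + \<delta> = 1"
  shows "a powr \<alpha> * b powr \<beta> * c powr \<delta> \<le> a + b + c"
proof (cases "a = 0 \<or> b = 0 \<or> c = 0")
  case True
  then show ?thesis using assms by auto
next
  case False
  then have pos: "0 < a" "0 < b" "0 < c" using assms by auto
  define M where "M = max a (max b c)"
  have "a powr \<alpha> * b powr \<beta> * c powr \<delta> \<le> M powr \<alpha> * M powr \<beta> * M powr \<delta>"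
    using assms pos by (intro mult_mono powr_mono2) (auto simp: M_def)
  also have "\<dots> = M powr (\<alpha> + \<beta> + \<delta>)" by (simp add: powr_add)
  also have "\<dots> = M" using assms pos by (simp add: M_def)
  also have "M \<le> a + b + c" using pos by (simp add: M_def)
  finally show ?thesis .
qed

text \<open>An exponent of at least 2 flattens the kink at 0, so the cutoff is C^1 across the edge
  of its support, as the extended test class demands.\<close>

lemma has_real_derivative_max_power:
  assumes "2 \<le> k"
  shows "((\<lambda>t. max 0 t ^ k) has_real_derivative real k * max 0 t ^ (k - 1)) (at t)"
proof (cases t "0::real" rule: linorder_cases)
  case less
  have "((\<lambda>_. 0) has_real_derivative 0) (at t)" by simp
  then have "((\<lambda>t. max 0 t ^ k) has_real_derivative 0) (at t)"
    by (rule has_field_derivative_transform_within_open[where S="{..<0}"])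
      (use less assms in \<open>auto simp: max_def\<close>)
  then show ?thesis using less assms by (simp add: max_def power_0_left)
next
  case greater
  have "((\<lambda>t. t ^ k) has_real_derivative real k * t ^ (k - 1)) (at t)"
    by (auto intro!: derivative_eq_intros)
  then have "((\<lambda>t. max 0 t ^ k) has_real_derivative real k * t ^ (k - 1)) (at t)"
    by (rule has_field_derivative_transform_within_open[where S="{0<..}"])
      (use greater in \<open>auto simp: max_def\<close>)
  then show ?thesis using greater by (simp add: max_def)
next
  case equal
  have "((\<lambda>h::real. max 0 h ^ (k - 1)) \<longlongrightarrow> max 0 0 ^ (k - 1)) (at 0)"
    by (intro tendsto_intros)
  then have "((\<lambda>h::real. max 0 h ^ (k - 1)) \<longlongrightarrow> 0) (at 0)" using assms by (simp add: zero_power)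
  then have "((\<lambda>h::real. (max 0 h ^ k - max 0 0 ^ k) / (h - 0)) \<longlongrightarrow> 0) (at 0)"
  proof (rule Lim_null_comparison[rotated])
    show "\<forall>\<^sub>F h in at 0. norm ((max 0 h ^ k - max 0 0 ^ k) / (h - 0 :: real)) \<le> max 0 h ^ (k - 1)"
    proof (rule always_eventually, rule allI)
      fix h :: real
      have "max 0 h ^ k = max 0 h ^ (k - 1) * max 0 h"
        using assms power_minus_mult[of k "max 0 h"] by simp
      then show "norm ((max 0 h ^ k - max 0 0 ^ k) / (h - 0)) \<le> max 0 h ^ (k - 1)"
        using assms by (cases "0 < h") (auto simp: max_def zero_power)
    qed
  qed
  then show ?thesis using equal assms by (simp add: has_field_derivative_iff zero_power)
qed

section \<open>Test functions depending on u\<close>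

lemma integrable_if_nn_integral_le:
  fixes f :: "'a \<Rightarrow> real"
  assumes "f \<in> borel_measurable M" "\<And>x. 0 \<le> f x" "(\<integral>\<^sup>+x. ennreal (f x) \<partial>M) \<le> ennreal \<eta>" "0 \<le> \<eta>"
  shows "integrable M f" "(LINT x|M. f x) \<le> \<eta>"
proof -
  show i: "integrable M f"
    using assms by (intro integrableI_nonneg) (auto simp: order_le_less_trans)
  show "(LINT x|M. f x) \<le> \<eta>"
    using assms nn_integral_eq_integral[OF i] by simp
qed

text \<open>The gradient of the mollified \<open>u\<close> enters only through products with \<open>A\<close>, which
  \<open>mollify_converges\<close> controls.\<close>

lemma weak_inequality_composed_test:
  fixes G A Z :: "'a::euclidean_space \<Rightarrow> 'a" and u w \<zeta> :: "'a \<Rightarrow> real" and \<psi> \<psi>' :: "real \<Rightarrow> real"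
  assumes p: "1 < p" and G: "Lp_borel p G" and A: "A \<in> borel_measurable borel"
    and AC: "\<And>x. norm (A x) \<le> C * norm (G x) powr (p - 1)" and "0 < C"
    and u: "continuous_on UNIV u" "\<And>x. 0 < u x" and weak: "is_weak_gradient u G"
    and w: "continuous_on UNIV w"
    and ineq: "\<And>\<phi>. \<phi> \<in> test_functions \<Longrightarrow> (\<And>x. 0 \<le> \<phi> x) \<Longrightarrow>
      (LINT x|lborel. A x \<bullet> grad \<phi> x) \<le> (LINT x|lborel. w x * \<phi> x)"
    and \<psi>: "\<And>t. 0 < t \<Longrightarrow> (\<psi> has_real_derivative \<psi>' t) (at t)" "continuous_on {0<..} \<psi>'"
      "\<And>t. 0 < t \<Longrightarrow> 0 \<le> \<psi> t"
    and \<zeta>: "\<And>x. (\<zeta> has_derivative (\<lambda>v. Z x \<bullet> v)) (at x)" "continuous_on UNIV Z"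
      "\<And>x. 0 \<le> \<zeta> x" "\<And>x. R \<le> norm x \<Longrightarrow> \<zeta> x = 0" "\<And>x. R \<le> norm x \<Longrightarrow> Z x = 0" and "0 < R"
  shows "integrable lborel (\<lambda>x. A x \<bullet> ((\<psi>' (u x) * \<zeta> x) *\<^sub>R G x + \<psi> (u x) *\<^sub>R Z x))" (is ?int)
    and "(LINT x|lborel. A x \<bullet> ((\<psi>' (u x) * \<zeta> x) *\<^sub>R G x + \<psi> (u x) *\<^sub>R Z x))
      \<le> (LINT x|lborel. w x * (\<psi> (u x) * \<zeta> x))" (is ?le)
proof -
  have bounded: "\<exists>B>0. \<forall>x\<in>K. norm (h x) \<le> B" if "compact K" "continuous_on K h"
    for h :: "'c::topological_space \<Rightarrow> 'd::real_normed_vector" and K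
    using compact_imp_bounded[OF compact_continuous_image[OF that(2,1)]] by (auto simp: bounded_pos)
  have c\<zeta>: "continuous_on UNIV \<zeta>" by (rule has_derivative_imp_continuous_on_UNIV[OF \<zeta>(1)])
  have c\<psi>: "continuous_on {0<..} \<psi>"
    using \<psi>(1) by (meson DERIV_isCont continuous_at_imp_continuous_on greaterThan_iff)
  have cu: "continuous_on UNIV (\<lambda>x. \<psi> (u x))" "continuous_on UNIV (\<lambda>x. \<psi>' (u x))"
    by (rule continuous_on_compose2[OF c\<psi> u(1)] continuous_on_compose2[OF \<psi>(2) u(1)]; use u(2) in auto)+
  have [measurable]: "G \<in> borel_measurable borel" using G by (rule Lp_borel_measurable)
  note [measurable] = A borel_measurable_continuous_onI[OF c\<zeta>] borel_measurable_continuous_onI[OF cu(1)]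
    borel_measurable_continuous_onI[OF cu(2)] borel_measurable_continuous_onI[OF \<zeta>(2)]
    borel_measurable_continuous_onI[OF w]
  define i :: "'a \<Rightarrow> real" where "i = indicator (cball 0 R)"
  have iG: "integrable lborel (\<lambda>x. i x * norm (G x) powr s)" if "0 \<le> s" "s \<le> p" for s
    unfolding i_def by (rule Lp_borel_integrable_powr[OF G that])
  have A1: "Lp_borel 1 A"
    unfolding Lp_borel_def
  proof (intro conjI allI A)
    fix r
    have "integrable lborel (\<lambda>x. C * (indicator (cball 0 r) x * norm (G x) powr (p - 1)))"
      using p by (intro integrable_mult_right Lp_borel_integrable_powr[OF G]) auto
    then show "integrable lborel (\<lambda>x. indicator (cball 0 r) x * norm (A x) powr 1)"
    proof (rule Bochner_Integration.integrable_bound)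
      show "(\<lambda>x. indicator (cball 0 r) x * norm (A x) powr 1) \<in> borel_measurable lborel"
        by (intro borel_measurable_times borel_measurable_indicator powr_real_measurable) auto
      show "AE x in lborel. norm (indicator (cball 0 r) x * norm (A x) powr 1)
         \<le> norm (C * (indicator (cball 0 r) x * norm (G x) powr (p - 1)))"
        using AC \<open>0 < C\<close> by (intro AE_I2) (auto simp: indicator_def)
    qed
  qed
  have K: "cball (0::'a) (R + 1) \<noteq> {}" "continuous_on (cball 0 (R + 1)) u"
    using \<open>0 < R\<close> continuous_on_subset[OF u(1)] by auto
  obtain x1 where x1: "\<And>x. x \<in> cball 0 (R + 1) \<Longrightarrow> u x1 \<le> u x"
    using continuous_attains_inf[OF compact_cball K] by blast
  obtain x2 where x2: "\<And>x. x \<in> cball 0 (R + 1) \<Longrightarrow> u x \<le> u x2"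
    using continuous_attains_sup[OF compact_cball K] by blast
  \<comment> \<open>Half the minimum and one more than the maximum of \<open>u\<close> on the ball:
    every function within \<open>min m1 1\<close> of \<open>u\<close> has its values there in
    \<open>{m1..m2}\<close>.\<close>
  define m1 m2 where "m1 = u x1 / 2" and "m2 = u x2 + 1"
  have m: "0 < m1" "{m1..m2} \<subseteq> {0<..}"
    using u(2)[of x1] by (auto simp: m1_def)
  have um: "u x - m1 \<ge> m1" "u x \<le> m2 - 1" if "norm x \<le> R + 1" for x
    using x1[of x] x2[of x] that by (auto simp: m1_def m2_def)
  obtain B\<zeta> where B\<zeta>: "B\<zeta> > 0" "\<And>x. x \<in> cball 0 R \<Longrightarrow> \<bar>\<zeta> x\<bar> \<le> B\<zeta>"
    using bounded[OF compact_cball continuous_on_subset[OF c\<zeta>]] by (metis real_norm_def subset_UNIV)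
  obtain BZ where BZ: "BZ > 0" "\<And>x. x \<in> cball 0 R \<Longrightarrow> norm (Z x) \<le> BZ"
    using bounded[OF compact_cball continuous_on_subset[OF \<zeta>(2)]] by (metis subset_UNIV)
  obtain B\<psi>' where B\<psi>': "B\<psi>' > 0" "\<And>t. t \<in> {m1..m2} \<Longrightarrow> \<bar>\<psi>' t\<bar> \<le> B\<psi>'"
    using bounded[OF compact_Icc continuous_on_subset[OF \<psi>(2) m(2)]] by (metis real_norm_def)
  obtain B\<psi> where B\<psi>: "B\<psi> > 0" "\<And>t. t \<in> {m1..m2} \<Longrightarrow> \<bar>\<psi> t\<bar> \<le> B\<psi>"
    using bounded[OF compact_Icc continuous_on_subset[OF c\<psi> m(2)]] by (metis real_norm_def)
  define D0 where "D0 x = (\<psi>' (u x) * \<zeta> x) *\<^sub>R G x + \<psi> (u x) *\<^sub>R Z x" for x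
  have out0: "D0 x = 0" if "R \<le> norm x" for x using \<zeta>(4,5) that by (simp add: D0_def)
  have [measurable]: "D0 \<in> borel_measurable borel" unfolding D0_def[abs_def] by measurable
  \<comment> \<open>The limiting test gradient contains \<open>G\<close> and so is not continuous;
    this majorant, with powers \<open>p\<close> and \<open>p - 1\<close> of
    \<open>norm (G x)\<close>, gives integrability instead.\<close>
  have AD0: "norm (A x \<bullet> D0 x) \<le> C * (B\<psi>' * B\<zeta> * (i x * norm (G x) powr p) + B\<psi> * BZ * (i x * norm (G x) powr (p - 1)))"
    for x
  proof (cases "norm x \<le> R")
    case True
    then have b: "\<bar>\<psi>' (u x)\<bar> \<le> B\<psi>'" "\<bar>\<psi> (u x)\<bar> \<le> B\<psi>" "\<bar>\<zeta> x\<bar> \<le> B\<zeta>" "norm (Z x) \<le> BZ"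
      using um[of x] m B\<psi>' B\<psi> B\<zeta> BZ by auto
    have "norm (A x \<bullet> D0 x) \<le> norm (A x) * norm (D0 x)" by (rule Cauchy_Schwarz_ineq2[folded real_norm_def])
    also have "\<dots> \<le> (C * norm (G x) powr (p - 1)) * (B\<psi>' * B\<zeta> * norm (G x) + B\<psi> * BZ)"
    proof (intro mult_mono AC)
      have "norm (D0 x) \<le> \<bar>\<psi>' (u x)\<bar> * \<bar>\<zeta> x\<bar> * norm (G x) + \<bar>\<psi> (u x)\<bar> * norm (Z x)"
        unfolding D0_def by (rule order_trans[OF norm_triangle_ineq]) (simp add: abs_mult)
      also have "\<dots> \<le> B\<psi>' * B\<zeta> * norm (G x) + B\<psi> * BZ"
        using b B\<psi>' B\<psi> B\<zeta> by (intro add_mono mult_mono) auto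
      finally show "norm (D0 x) \<le> B\<psi>' * B\<zeta> * norm (G x) + B\<psi> * BZ" .
    qed (use \<open>0 < C\<close> in auto)
    also have "\<dots> = C * (B\<psi>' * B\<zeta> * (norm (G x) powr (p - 1) * norm (G x)) + B\<psi> * BZ * norm (G x) powr (p - 1))"
      by (simp add: algebra_simps)
    also have "norm (G x) powr (p - 1) * norm (G x) = norm (G x) powr p"
      by (cases "G x = 0") (auto simp: powr_diff)
    finally show ?thesis using True by (simp add: i_def)
  qed (use out0[of x] in \<open>simp add: i_def\<close>)
  show int0: ?int
    unfolding D0_def[symmetric]
  proof (rule Bochner_Integration.integrable_bound)
    show "integrable lborel (\<lambda>x. C * (B\<psi>' * B\<zeta> * (i x * norm (G x) powr p) + B\<psi> * BZ * (i x * norm (G x) powr (p - 1))))"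
      using p by (intro integrable_mult_right Bochner_Integration.integrable_add iG) auto
    show "AE x in lborel. norm (A x \<bullet> D0 x) \<le> norm (C * (B\<psi>' * B\<zeta> * (i x * norm (G x) powr p) + B\<psi> * BZ * (i x * norm (G x) powr (p - 1))))"
      using AD0 by (intro AE_I2) (metis abs_ge_self order_trans real_norm_def)
  qed measurable
  have iw: "integrable lborel (\<lambda>x. i x *\<^sub>R \<bar>w x\<bar>)"
    unfolding i_def by (rule borel_integrable_compact) (auto intro!: continuous_intros continuous_on_subset[OF w])
  have iw\<phi>: "integrable lborel (\<lambda>x. w x * h x)" if "continuous_on UNIV h" "\<And>x. R \<le> norm x \<Longrightarrow> h x = 0" for h
    by (rule integrable_continuous_bounded_support[where r=R]) (auto intro!: continuous_intros w that(1) simp: that(2))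
  have iw\<phi>0: "integrable lborel (\<lambda>x. w x * (\<psi> (u x) * \<zeta> x))"
    by (rule iw\<phi>) (auto intro!: continuous_intros cu c\<zeta> simp: \<zeta>(4))
  show ?le
    unfolding D0_def[symmetric]
  proof (rule le_if_le_add_mult_eps)
    fix \<eta> :: real assume "0 < \<eta>"
    have "uniformly_continuous_on {m1..m2} \<psi>'"
      by (rule compact_uniformly_continuous[OF continuous_on_subset[OF \<psi>(2) m(2)]]) simp
    then obtain \<delta>1 where \<delta>1: "\<delta>1 > 0" "\<And>s t. s \<in> {m1..m2} \<Longrightarrow> t \<in> {m1..m2} \<Longrightarrow> \<bar>t - s\<bar> < \<delta>1 \<Longrightarrow> \<bar>\<psi>' t - \<psi>' s\<bar> < \<eta>"
      using \<open>0 < \<eta>\<close> unfolding uniformly_continuous_on_def dist_real_def by metis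
    have "uniformly_continuous_on {m1..m2} \<psi>"
      by (rule compact_uniformly_continuous[OF continuous_on_subset[OF c\<psi> m(2)]]) simp
    then obtain \<delta>2 where \<delta>2: "\<delta>2 > 0" "\<And>s t. s \<in> {m1..m2} \<Longrightarrow> t \<in> {m1..m2} \<Longrightarrow> \<bar>t - s\<bar> < \<delta>2 \<Longrightarrow> \<bar>\<psi> t - \<psi> s\<bar> < \<eta>"
      using \<open>0 < \<eta>\<close> unfolding uniformly_continuous_on_def dist_real_def by metis
    \<comment> \<open>The first minimum keeps the mollification of \<open>u\<close> in
      \<open>{m1..m2}\<close>; halving the second gives the strict inequalities for the moduli of
      continuity of \<open>\<psi>\<close> and \<open>\<psi>'\<close>.\<close>
    define \<delta> where "\<delta> = min (min m1 1) (min \<delta>1 \<delta>2 / 2)"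
    have \<delta>: "\<delta> > 0" "\<delta> \<le> m1" "\<delta> \<le> 1" "\<delta> < \<delta>1" "\<delta> < \<delta>2" using m \<delta>1 \<delta>2 by (auto simp: \<delta>_def)
    obtain d1 where d1: "d1 > 0" "d1 \<le> 1" "\<And>x z. norm x \<le> R \<Longrightarrow> norm z \<le> d1 \<Longrightarrow> norm (u (x + z) - u x) \<le> \<delta>"
      using uniform_translation[OF u(1) \<open>\<delta> > 0\<close>, of R] by blast
    obtain d2 where d2: "d2 > 0" "d2 \<le> 1" "\<And>e \<rho>. e \<le> d2 \<Longrightarrow> mollifier e \<rho> \<Longrightarrow>
      (\<integral>\<^sup>+x. ennreal (i x * (norm (G x) powr (p - 1) * norm (mollify \<rho> G x - G x))) \<partial>lborel) \<le> ennreal \<eta>"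
      using mollify_converges[OF G p \<open>0 < \<eta>\<close>, of R] unfolding i_def by blast
    define d where "d = min d1 d2"
    have d: "d > 0" "d \<le> d1" "d \<le> d2" using d1 d2 by (auto simp: d_def)
    obtain \<rho> :: "'a \<Rightarrow> real" where \<rho>: "mollifier d \<rho>" using mollifier_exists[OF d(1)] by blast
    define v where "v = mollify \<rho> u"
    define V where "V = mollify \<rho> G"
    have vd: "(v has_derivative (\<lambda>h. V x \<bullet> h)) (at x)" for x
      unfolding v_def V_def using p by (intro grad_mollify_weak_gradient[OF u(1) G _ weak \<rho>]) simp
    have cV: "continuous_on UNIV V"
      unfolding V_def using p by (intro grad_mollify_weak_gradient[OF u(1) G _ weak \<rho>]) simp
    note [measurable] = borel_measurable_continuous_onI[OF cV]
    have cv: "continuous_on UNIV v" by (rule has_derivative_imp_continuous_on_UNIV[OF vd])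
    \<comment> \<open>Needed at every point, also outside the support of \<open>\<zeta>\<close>:
      \<open>\<psi>\<close> is differentiable on the positive reals only, and the chain rule is
      applied everywhere.\<close>
    have vpos: "0 < v x" for x
    proof -
      have "cball x d \<noteq> {}" "continuous_on (cball x d) u"
        using d(1) continuous_on_subset[OF u(1)] by auto
      then obtain y where y: "\<And>z. z \<in> cball x d \<Longrightarrow> u y \<le> u z"
        using continuous_attains_inf[OF compact_cball] by metis
      have "u y \<le> v x" unfolding v_def
        by (rule mollify_lower_bound[OF u(1) \<rho>]) (auto intro!: y simp: dist_norm)
      then show ?thesis using u(2)[of y] by simp
    qed
    have vu: "\<bar>v x - u x\<bar> \<le> \<delta>" if "norm x \<le> R" for x
      using mollify_dist_le[OF u(1) \<rho>, of x \<delta>] d1(3)[OF that] d by (auto simp: v_def)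
    define \<phi> where "\<phi> x = \<psi> (v x) * \<zeta> x" for x
    define D where "D x = (\<psi>' (v x) * \<zeta> x) *\<^sub>R V x + \<psi> (v x) *\<^sub>R Z x" for x
    have cv': "continuous_on UNIV (\<lambda>x. \<psi> (v x))" "continuous_on UNIV (\<lambda>x. \<psi>' (v x))"
      by (rule continuous_on_compose2[OF c\<psi> cv] continuous_on_compose2[OF \<psi>(2) cv]; use vpos in auto)+
    have d\<phi>: "(\<phi> has_derivative (\<lambda>h. D x \<bullet> h)) (at x)" for x
    proof -
      have "((\<lambda>x. \<psi> (v x)) has_derivative (\<lambda>h. \<psi>' (v x) * (V x \<bullet> h))) (at x)"
        by (rule has_derivative_compose[OF vd \<psi>(1)[OF vpos, unfolded has_field_derivative_def]])
      from has_derivative_mult[OF this \<zeta>(1)] show ?thesis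
        unfolding \<phi>_def[abs_def] D_def by (rule has_derivative_eq_rhs) (auto simp: algebra_simps)
    qed
    have cD: "continuous_on UNIV D"
      unfolding D_def[abs_def] by (intro continuous_intros cv' c\<zeta> cV \<zeta>(2))
    have outD: "\<phi> x = 0" "D x = 0" if "R \<le> norm x" for x using \<zeta>(4,5) that by (auto simp: \<phi>_def D_def)
    have key: "(LINT x|lborel. A x \<bullet> D x) \<le> (LINT x|lborel. w x * \<phi> x)"
      by (rule weak_inequality_C1_test[OF A1 w ineq d\<phi> cD, where R=R])
        (use \<psi>(3)[OF vpos] \<zeta>(3) outD in \<open>auto simp: \<phi>_def\<close>)
    define J where "J x = i x * (norm (G x) powr (p - 1) * norm (V x - G x))" for x
    have i0: "0 \<le> i x" for x by (simp add: i_def)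
    have [measurable]: "i \<in> borel_measurable borel"
      unfolding i_def by (intro borel_measurable_indicator borel_closed closed_cball)
    have J1: "J \<in> borel_measurable lborel" unfolding J_def[abs_def] by measurable
    have J2: "0 \<le> J x" for x using i0 by (simp add: J_def)
    have J3: "(\<integral>\<^sup>+x. ennreal (J x) \<partial>lborel) \<le> ennreal \<eta>"
      using d2(3)[OF d(3) \<rho>] unfolding J_def V_def .
    note J = integrable_if_nn_integral_le[OF J1 J2 J3 less_imp_le[OF \<open>0 < \<eta>\<close>]]
    have bnd: "x \<in> cball 0 R \<Longrightarrow> \<bar>\<psi>' (u x) - \<psi>' (v x)\<bar> \<le> \<eta> \<and> \<bar>\<psi> (u x) - \<psi> (v x)\<bar> \<le> \<eta> \<and> \<bar>\<psi>' (v x)\<bar> \<le> B\<psi>'" for x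
    proof -
      assume "x \<in> cball 0 R"
      then have x: "norm x \<le> R" by simp
      have mem: "u x \<in> {m1..m2}" "v x \<in> {m1..m2}"
        using um[of x] vu[OF x] \<delta> m x by (auto simp: abs_le_iff)
      have "\<bar>u x - v x\<bar> < \<delta>1" "\<bar>u x - v x\<bar> < \<delta>2" using vu[OF x] \<delta> by auto
      then show ?thesis using \<delta>1(2)[OF mem(2,1)] \<delta>2(2)[OF mem(2,1)] B\<psi>'(2)[OF mem(2)] by auto
    qed
    let ?E = "\<lambda>x. C * (B\<psi>' * B\<zeta> * J x + \<eta> * B\<zeta> * (i x * norm (G x) powr p) + \<eta> * BZ * (i x * norm (G x) powr (p - 1)))"
    have intE: "integrable lborel ?E"
      using p by (intro integrable_mult_right Bochner_Integration.integrable_add iG J) auto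
    have intD: "integrable lborel (\<lambda>x. A x \<bullet> D x)"
      by (rule integrable_inner_bounded_support[OF A1 cD outD(2)])
    have pw: "A x \<bullet> D0 x \<le> A x \<bullet> D x + ?E x" for x
    proof (cases "x \<in> cball 0 R")
      case True
      note b = bnd[OF True] B\<zeta>(2)[OF True] BZ(2)[OF True]
      \<comment> \<open>Only the first summand compares gradients, and its coefficient is bounded,
        so \<open>J\<close> controls it. The other two have coefficients of size
        \<open>\<eta>\<close> multiplying a fixed integrable function once paired with
        \<open>A\<close>.\<close>
      have "D0 x - D x = (\<psi>' (v x) * \<zeta> x) *\<^sub>R (G x - V x) + ((\<psi>' (u x) - \<psi>' (v x)) * \<zeta> x) *\<^sub>R G x + (\<psi> (u x) - \<psi> (v x)) *\<^sub>R Z x"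
        by (simp add: D0_def D_def algebra_simps)
      also have "norm \<dots> \<le> \<bar>\<psi>' (v x)\<bar> * \<bar>\<zeta> x\<bar> * norm (V x - G x) + \<bar>\<psi>' (u x) - \<psi>' (v x)\<bar> * \<bar>\<zeta> x\<bar> * norm (G x) + \<bar>\<psi> (u x) - \<psi> (v x)\<bar> * norm (Z x)"
        by (intro order_trans[OF norm_triangle_ineq] add_mono) (simp_all add: abs_mult norm_minus_commute)
      also have "\<dots> \<le> B\<psi>' * B\<zeta> * norm (V x - G x) + \<eta> * B\<zeta> * norm (G x) + \<eta> * BZ"
        using b B\<psi>' B\<zeta> \<open>0 < \<eta>\<close> by (intro add_mono mult_mono) auto
      finally have n: "norm (D0 x - D x) \<le> B\<psi>' * B\<zeta> * norm (V x - G x) + \<eta> * B\<zeta> * norm (G x) + \<eta> * BZ" .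
      have "A x \<bullet> (D0 x - D x) \<le> norm (A x) * norm (D0 x - D x)" by (rule norm_cauchy_schwarz)
      also have "\<dots> \<le> (C * norm (G x) powr (p - 1)) * (B\<psi>' * B\<zeta> * norm (V x - G x) + \<eta> * B\<zeta> * norm (G x) + \<eta> * BZ)"
        using \<open>0 < C\<close> by (intro mult_mono AC n) auto
      also have "\<dots> = C * (B\<psi>' * B\<zeta> * (norm (G x) powr (p - 1) * norm (V x - G x)) + \<eta> * B\<zeta> * (norm (G x) powr (p - 1) * norm (G x)) + \<eta> * BZ * norm (G x) powr (p - 1))"
        by (simp add: algebra_simps)
      also have "norm (G x) powr (p - 1) * norm (G x) = norm (G x) powr p"
        by (cases "G x = 0") (auto simp: powr_diff)
      finally show ?thesis using True by (simp add: inner_diff_right J_def i_def)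
    next
      case False
      then show ?thesis using outD[of x] out0[of x] by (simp add: J_def i_def)
    qed
    have "(LINT x|lborel. A x \<bullet> D0 x) \<le> (LINT x|lborel. A x \<bullet> D x + ?E x)"
      by (rule integral_mono[OF int0[folded D0_def] _ pw]) (use intD intE in auto)
    also have "\<dots> = (LINT x|lborel. A x \<bullet> D x) + (LINT x|lborel. ?E x)"
      by (rule Bochner_Integration.integral_add[OF intD intE])
    also have "(LINT x|lborel. ?E x) = C * (B\<psi>' * B\<zeta> * (LINT x|lborel. J x) + \<eta> * B\<zeta> * (LINT x|lborel. i x * norm (G x) powr p)
        + \<eta> * BZ * (LINT x|lborel. i x * norm (G x) powr (p - 1)))"
      using J(1) iG[of p] iG[of "p - 1"] p by simp
    finally have le1: "(LINT x|lborel. A x \<bullet> D0 x) \<le> (LINT x|lborel. A x \<bullet> D x) +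
       C * (B\<psi>' * B\<zeta> * (LINT x|lborel. J x) + \<eta> * B\<zeta> * (LINT x|lborel. i x * norm (G x) powr p)
        + \<eta> * BZ * (LINT x|lborel. i x * norm (G x) powr (p - 1)))" .
    have "(LINT x|lborel. w x * \<phi> x) \<le> (LINT x|lborel. w x * (\<psi> (u x) * \<zeta> x) + \<eta> * B\<zeta> * (i x *\<^sub>R \<bar>w x\<bar>))"
    proof (rule integral_mono)
      show "integrable lborel (\<lambda>x. w x * \<phi> x)"
        by (rule iw\<phi>[OF has_derivative_imp_continuous_on_UNIV[OF d\<phi>] outD(1)])
      show "integrable lborel (\<lambda>x. w x * (\<psi> (u x) * \<zeta> x) + \<eta> * B\<zeta> * (i x *\<^sub>R \<bar>w x\<bar>))"
        by (intro Bochner_Integration.integrable_add integrable_mult_right iw iw\<phi>0)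
      fix x
      show "w x * \<phi> x \<le> w x * (\<psi> (u x) * \<zeta> x) + \<eta> * B\<zeta> * (i x *\<^sub>R \<bar>w x\<bar>)"
      proof (cases "x \<in> cball 0 R")
        case True
        have "w x * \<phi> x - w x * (\<psi> (u x) * \<zeta> x) = w x * ((\<psi> (v x) - \<psi> (u x)) * \<zeta> x)"
          by (simp add: \<phi>_def algebra_simps)
        also have "\<dots> \<le> \<bar>w x\<bar> * (\<bar>\<psi> (u x) - \<psi> (v x)\<bar> * \<bar>\<zeta> x\<bar>)"
          by (metis abs_ge_self abs_minus_commute abs_mult)
        also have "\<dots> \<le> \<bar>w x\<bar> * (\<eta> * B\<zeta>)"
          using bnd[OF True] B\<zeta>(2)[OF True] \<open>0 < \<eta>\<close> by (intro mult_mono) auto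
        finally show ?thesis using True by (simp add: i_def mult.commute)
      next
        case False
        then show ?thesis using outD[of x] \<zeta>(4)[of x] by (simp add: i_def)
      qed
    qed
    also have "\<dots> = (LINT x|lborel. w x * (\<psi> (u x) * \<zeta> x)) + \<eta> * B\<zeta> * (LINT x|lborel. i x *\<^sub>R \<bar>w x\<bar>)"
      using iw iw\<phi>0 by (subst Bochner_Integration.integral_add) auto
    finally have le2: "(LINT x|lborel. w x * \<phi> x) \<le> (LINT x|lborel. w x * (\<psi> (u x) * \<zeta> x)) + \<eta> * B\<zeta> * (LINT x|lborel. i x *\<^sub>R \<bar>w x\<bar>)" .
    have "C * (B\<psi>' * B\<zeta> * (LINT x|lborel. J x)) \<le> C * (B\<psi>' * B\<zeta> * \<eta>)"
      using J(2) \<open>0 < C\<close> B\<psi>'(1) B\<zeta>(1) by (intro mult_left_mono) auto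
    with le1 le2 key show "(LINT x|lborel. A x \<bullet> D0 x) \<le> (LINT x|lborel. w x * (\<psi> (u x) * \<zeta> x)) +
      \<eta> * (C * (B\<psi>' * B\<zeta> + B\<zeta> * (LINT x|lborel. i x * norm (G x) powr p) + BZ * (LINT x|lborel. i x * norm (G x) powr (p - 1)))
        + B\<zeta> * (LINT x|lborel. i x *\<^sub>R \<bar>w x\<bar>))"
      by (simp add: algebra_simps)
  qed
qed

section \<open>Borel representatives of weak gradients\<close>

lemma lebesgue_borel_representative:
  fixes G :: "'a::euclidean_space \<Rightarrow> 'b::euclidean_space"
  assumes "G \<in> borel_measurable lebesgue"
  shows "\<exists>G'\<in>borel_measurable borel. AE x in lebesgue. G x = G' x"
proof -
  have "\<exists>g\<in>borel_measurable lborel. AE x in lborel. G x \<bullet> b = g x" for b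
    by (rule completion_ex_borel_measurable_real) (use assms in measurable)
  then obtain g where g: "\<And>b. g b \<in> borel_measurable lborel" "\<And>b. AE x in lborel. G x \<bullet> b = g b x"
    by metis
  define G' where "G' x = (\<Sum>b\<in>Basis. g b x *\<^sub>R b)" for x
  note [measurable] = g(1)
  have "G' \<in> borel_measurable borel" unfolding G'_def[abs_def] by measurable
  moreover have "AE x in lborel. \<forall>b\<in>Basis. G x \<bullet> b = g b x"
    using g(2) by (intro AE_finite_allI) auto
  then have "AE x in lborel. G x = G' x"
  proof eventually_elim
    case (elim x)
    then have "G' x = (\<Sum>b\<in>Basis. (G x \<bullet> b) *\<^sub>R b)" by (simp add: G'_def)
    then show ?case by (simp add: euclidean_representation)
  qed
  then have "AE x in lebesgue. G x = G' x" by (rule AE_completion)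
  ultimately show ?thesis by blast
qed

text \<open>Integrability and the weak gradient identity depend on \<open>G\<close> only up to null
  sets, so the Borel function required for translations may take its place.\<close>

lemma W1p_loc_borel_representative:
  fixes u :: "'a::euclidean_space \<Rightarrow> real"
  assumes "W1p_loc p u G"
  obtains G' where "Lp_borel p G'" "is_weak_gradient u G'" "AE x in lebesgue. G x = G' x"
proof -
  have Gm: "G \<in> borel_measurable lebesgue"
    and GK: "\<And>K. compact K \<Longrightarrow> set_integrable lebesgue K (\<lambda>x. norm (G x) powr p)"
    and weak: "is_weak_gradient u G"
    using assms by (auto simp: W1p_loc_def Lp_loc_def)
  obtain G' where G': "G' \<in> borel_measurable borel" and ae: "AE x in lebesgue. G x = G' x"
    using lebesgue_borel_representative[OF Gm] by blast
  note [measurable] = G'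
  have G'm: "G' \<in> borel_measurable lebesgue" using G' by (simp add: measurable_completion)
  show ?thesis
  proof (rule that[OF _ _ ae])
    show "Lp_borel p G'"
      unfolding Lp_borel_def
    proof (intro conjI allI G')
      fix R
      have m: "(\<lambda>x. indicator (cball 0 R) x * norm (G' x) powr p) \<in> borel_measurable lborel"
        by (intro borel_measurable_times borel_measurable_indicator powr_real_measurable) auto
      have "integrable lebesgue (\<lambda>x. indicator (cball 0 R) x * norm (G x) powr p)"
        using GK[of "cball 0 R"] by (simp add: set_integrable_def)
      then have "integrable lebesgue (\<lambda>x. indicator (cball 0 R) x * norm (G' x) powr p)"
        by (rule integrable_cong_AE_imp) (use m ae in \<open>auto simp: measurable_completion\<close>)
      then show "integrable lborel (\<lambda>x. indicator (cball 0 R) x * norm (G' x) powr p)"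
        using m by (simp add: integrable_completion)
    qed
    show "is_weak_gradient u G'"
      unfolding is_weak_gradient_def
    proof (intro ballI)
      fix \<phi> :: "'a \<Rightarrow> real" and b :: 'a assume \<phi>: "\<phi> \<in> test_functions" and b: "b \<in> Basis"
      have "\<phi> \<in> borel_measurable borel"
        using \<phi> unfolding test_functions_def by (auto intro!: borel_measurable_continuous_onI Ck_on_continuous)
      then have \<phi>m: "\<phi> \<in> borel_measurable lebesgue" by (simp add: measurable_completion)
      have "(LINT x|lebesgue. (G x \<bullet> b) * \<phi> x) = (LINT x|lebesgue. (G' x \<bullet> b) * \<phi> x)"
        by (rule integral_cong_AE) (use Gm G'm \<phi>m ae in \<open>auto intro: borel_measurable_times borel_measurable_inner\<close>)
      then show "(LINT x|lebesgue. u x * (grad \<phi> x \<bullet> b)) = - (LINT x|lebesgue. (G' x \<bullet> b) * \<phi> x)"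
        using weak \<phi> b unfolding is_weak_gradient_def by simp
    qed
  qed
qed

text \<open>The absorption at a single point: \<open>X\<close> stands for the norm of the weak
  gradient, \<open>s ^ k\<close> for the cutoff, \<open>E\<close> for the norm of its gradient, and
  \<open>g\<close> and \<open>\<Phi>\<close> for values at \<open>u\<close>. The left side is at
  most \<open>a powr \<alpha> * b powr \<beta> * r powr \<delta>\<close>, where \<open>a\<close>,
  \<open>b\<close> and \<open>r\<close> are the three terms on the right.\<close>

lemma keller_osserman_young:
  fixes X E s g \<Phi> p q c C N R :: real and k :: nat
  assumes p: "1 < p" and q: "p - 1 < q" and "0 < c" "0 < C" "0 < g" "0 < \<Phi>" "0 \<le> X" "0 < R" "0 < N"
    and s: "0 \<le> s" "s \<le> 1" and E: "0 \<le> E" "E \<le> N / R * s ^ (k - 1)" and k: "2 \<le> k"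
    and kd: "p * q / (q - p + 1) \<le> real k"
  defines "m \<equiv> (p - 1) * q / (q - p + 1)"
  shows "C * X powr (p - 1) * E * \<Phi> powr (- m)
    \<le> c * X powr p * (m * \<Phi> powr (- m - 1) * g powr (- 1 / q)) * s ^ k + g * \<Phi> powr (- m) * s ^ k / 2
      + (C * N / ((c * m) powr ((p - 1) / p) * (1 / 2) powr ((p - 1) / (p * q))) / R) powr (p * q / (q - p + 1))"
proof (cases "s = 0")
  case True
  \<comment> \<open>\<open>k - 1\<close> is positive, so the gradient bound vanishes together with
    \<open>s\<close>.\<close>
  then have "E = 0" using E k by (simp add: power_0_left)
  then show ?thesis using True k by (simp add: power_0_left)
next
  case False
  then have "0 < s" using s by simp
  have "0 < q" using p q by simp
  have d0: "0 < q - p + 1" using q by simp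
  have "0 < m" using p \<open>0 < q\<close> d0 by (simp add: m_def)
  \<comment> \<open>All forced: \<open>\<alpha>\<close> by the power of \<open>X\<close>,
    \<open>\<beta>\<close> by the cancellation of \<open>g\<close>, \<open>\<delta>\<close> by the
    sum 1. The value of \<open>m\<close> solves \<open>m * \<delta> = \<alpha>\<close>, the balance
    of the powers of \<open>\<Phi>\<close>.\<close>
  define \<alpha> \<beta> \<delta> where "\<alpha> = (p - 1) / p" and "\<beta> = (p - 1) / (p * q)" and "\<delta> = (q - p + 1) / (p * q)"
  have pos: "0 < \<alpha>" "0 < \<beta>" "0 < \<delta>" using p \<open>0 < q\<close> d0 by (auto simp: \<alpha>_def \<beta>_def \<delta>_def)
  have sum1: "\<alpha> + \<beta> + \<delta> = 1" using p \<open>0 < q\<close> by (simp add: \<alpha>_def \<beta>_def \<delta>_def field_simps)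
  have md: "m * \<delta> = \<alpha>" using p \<open>0 < q\<close> d0 by (simp add: \<alpha>_def \<delta>_def m_def)
  have ag: "\<alpha> / q = \<beta>" by (simp add: \<alpha>_def \<beta>_def)
  have di: "p * q / (q - p + 1) = 1 / \<delta>" by (simp add: \<delta>_def)
  \<comment> \<open>The differentiated cutoff \<open>s ^ (k - 1)\<close> must be at most the power
    \<open>real k * (\<alpha> + \<beta>)\<close> of \<open>s\<close> consumed by \<open>a\<close>
    and \<open>b\<close>. As \<open>s \<le> 1\<close>, this asks for the exponent comparison
    \<open>real k * (1 - \<delta>) \<le> real k - 1\<close>.\<close>
  have kd': "1 \<le> real k * \<delta>" using kd d0 p \<open>0 < q\<close> by (simp add: \<delta>_def field_simps)
  \<comment> \<open>The numerical factors \<open>c * m\<close> and \<open>1 / 2\<close> of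
    \<open>a\<close> and \<open>b\<close> after taking powers; \<open>r\<close> is divided by them
    in advance.\<close>
  define T where "T = (c * m) powr \<alpha> * (1 / 2) powr \<beta>"
  have "0 < T" using \<open>0 < c\<close> \<open>0 < m\<close> by (simp add: T_def)
  define a where "a = c * X powr p * (m * \<Phi> powr (- m - 1) * g powr (- 1 / q)) * s ^ k"
  define b where "b = g * \<Phi> powr (- m) * s ^ k / 2"
  define r where "r = (C * N / T / R) powr (1 / \<delta>)"
  have ea: "a powr \<alpha> = (c * m) powr \<alpha> * X powr (p - 1) * \<Phi> powr ((- m - 1) * \<alpha>) * g powr (- \<beta>) * s powr (real k * \<alpha>)"
  proof -
    have "a = (c * m) * X powr p * \<Phi> powr (- m - 1) * g powr (- 1 / q) * s powr real k"
      using \<open>0 < s\<close> by (simp add: a_def powr_realpow)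
    moreover have "p * \<alpha> = p - 1" "(- 1 / q) * \<alpha> = - \<beta>" using p ag by (auto simp: \<alpha>_def)
    ultimately show ?thesis using \<open>0 < c\<close> \<open>0 < m\<close> by (simp add: powr_mult powr_powr)
  qed
  have eb: "b powr \<beta> = (1 / 2) powr \<beta> * g powr \<beta> * \<Phi> powr (- m * \<beta>) * s powr (real k * \<beta>)"
  proof -
    have "b = (1 / 2) * g * \<Phi> powr (- m) * s powr real k"
      using \<open>0 < s\<close> by (simp add: b_def powr_realpow)
    then show ?thesis using \<open>0 < g\<close> by (simp only: powr_mult powr_powr)
  qed
  have er: "r powr \<delta> = C * N / T / R"
    using pos \<open>0 < C\<close> \<open>0 < N\<close> \<open>0 < T\<close> \<open>0 < R\<close> by (simp add: r_def powr_powr)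
  have "C * X powr (p - 1) * E * \<Phi> powr (- m) \<le> C * X powr (p - 1) * (N / R * s powr (real k * (\<alpha> + \<beta>))) * \<Phi> powr (- m)"
  proof (intro mult_right_mono mult_left_mono)
    have "s ^ (k - 1) = s powr (real k - 1)"
      using \<open>0 < s\<close> k by (simp add: powr_realpow[symmetric] of_nat_diff)
    also have "\<dots> \<le> s powr (real k * (\<alpha> + \<beta>))"
    proof (rule powr_mono')
      have "real k * (\<alpha> + \<beta>) = real k * (1 - \<delta>)" using sum1 by (simp add: eq_diff_eq)
      then show "real k * (\<alpha> + \<beta>) \<le> real k - 1" using kd' by (simp add: algebra_simps)
    qed (use s in auto)
    finally have "s ^ (k - 1) \<le> s powr (real k * (\<alpha> + \<beta>))" .
    then have "N / R * s ^ (k - 1) \<le> N / R * s powr (real k * (\<alpha> + \<beta>))"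
      using \<open>0 < N\<close> \<open>0 < R\<close> by (intro mult_left_mono) auto
    then show "E \<le> N / R * s powr (real k * (\<alpha> + \<beta>))" using E by simp
  qed (use \<open>0 < C\<close> in auto)
  also have "\<dots> = a powr \<alpha> * b powr \<beta> * r powr \<delta>"
  proof -
    have \<Phi>e: "\<Phi> powr ((- m - 1) * \<alpha>) * \<Phi> powr (- m * \<beta>) = \<Phi> powr (- m)"
    proof -
      have "(- m - 1) * \<alpha> + (- m * \<beta>) = - m * (\<alpha> + \<beta>) - \<alpha>" by (simp add: algebra_simps)
      also have "\<dots> = - m * (1 - \<delta>) - \<alpha>" using sum1 by (simp add: eq_diff_eq)
      also have "\<dots> = - m" using md by (simp add: algebra_simps)
      finally show ?thesis by (simp flip: powr_add)
    qed
    have ge: "g powr (- \<beta>) * g powr \<beta> = 1" using \<open>0 < g\<close> by (simp flip: powr_add)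
    have se: "s powr (real k * \<alpha>) * s powr (real k * \<beta>) = s powr (real k * (\<alpha> + \<beta>))"
      by (simp add: distrib_left powr_add)
    have "a powr \<alpha> * b powr \<beta> * r powr \<delta> =
      (T * X powr (p - 1)) * (\<Phi> powr ((- m - 1) * \<alpha>) * \<Phi> powr (- m * \<beta>)) * (g powr (- \<beta>) * g powr \<beta>)
      * (s powr (real k * \<alpha>) * s powr (real k * \<beta>)) * (C * N / T / R)"
      unfolding ea eb er T_def by (simp only: mult_ac)
    also have "\<dots> = (T * X powr (p - 1)) * \<Phi> powr (- m) * s powr (real k * (\<alpha> + \<beta>)) * (C * N / T / R)"
      unfolding \<Phi>e ge se by simp
    also have "\<dots> = C * X powr (p - 1) * (N / R * s powr (real k * (\<alpha> + \<beta>))) * \<Phi> powr (- m)"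
      using \<open>0 < T\<close> by simp
    finally show ?thesis by simp
  qed
  also have "\<dots> \<le> a + b + r"
    using \<open>0 < c\<close> \<open>0 < m\<close> \<open>0 < g\<close> s by (intro young_three pos sum1) (auto simp: a_def b_def r_def)
  finally show ?thesis
    unfolding a_def b_def r_def T_def \<alpha>_def \<beta>_def di .
qed

text \<open>On the support \<open>norm x \<le> R\<close>, which turns the coefficient
  \<open>2 / R\<^sup>2\<close> of \<open>x\<close> into the decay \<open>2 / R\<close> of the
  gradient.\<close>

lemma cutoff_has_derivative:
  fixes R :: real and k :: nat
  assumes "2 \<le> k" "0 < R"
  defines "s \<equiv> \<lambda>x::'a::euclidean_space. max 0 (1 - x \<bullet> x / R\<^sup>2)"
  defines "Z \<equiv> \<lambda>x. (real k * s x ^ (k - 1) * (- 2 / R\<^sup>2)) *\<^sub>R x"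
  shows "((\<lambda>x. s x ^ k) has_derivative (\<lambda>v. Z x \<bullet> v)) (at x)" "continuous_on UNIV Z"
    "R \<le> norm x \<Longrightarrow> s x = 0" "0 \<le> s x" "s x \<le> 1" "norm (Z x) \<le> 2 * real k / R * s x ^ (k - 1)"
proof -
  have "((\<lambda>x. 1 - x \<bullet> x / R\<^sup>2) has_derivative (\<lambda>v. - 2 / R\<^sup>2 * (x \<bullet> v))) (at x)"
    by (auto intro!: derivative_eq_intros simp: inner_commute divide_inverse)
  from has_derivative_compose[OF this has_real_derivative_max_power[OF assms(1), unfolded has_field_derivative_def]]
  show "((\<lambda>x. s x ^ k) has_derivative (\<lambda>v. Z x \<bullet> v)) (at x)"
    unfolding s_def Z_def by (simp add: mult.assoc)
  show "continuous_on UNIV Z" unfolding Z_def s_def divide_inverse by (intro continuous_intros)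
  show s0: "0 \<le> s x" and "s x \<le> 1" by (auto simp: s_def)
  have out: "s x = 0" if "R \<le> norm x"
  proof -
    have "R\<^sup>2 \<le> (norm x)\<^sup>2" using that assms(2) by (intro power_mono) auto
    then show ?thesis using assms(2) by (simp add: s_def dot_square_norm field_simps)
  qed
  then show "R \<le> norm x \<Longrightarrow> s x = 0" .
  show "norm (Z x) \<le> 2 * real k / R * s x ^ (k - 1)"
  proof (cases "R \<le> norm x")
    case True
    then show ?thesis using out assms(1) by (simp add: Z_def power_0_left)
  next
    case False
    have "norm (Z x) = 2 * real k / R\<^sup>2 * s x ^ (k - 1) * norm x"
      using s0 by (simp add: Z_def abs_mult)
    also have "\<dots> \<le> 2 * real k / R\<^sup>2 * s x ^ (k - 1) * R"
      using False s0 by (intro mult_left_mono) auto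
    also have "\<dots> = 2 * real k / R * s x ^ (k - 1)"
      using assms(2) by (simp add: power2_eq_square)
    finally show ?thesis .
  qed
qed

text \<open>Both ranges of \<open>p\<close> are covered by \<open>dim\<close>. It states that the
  error density, of order R^(-e) with \<open>e\<close> as below, decays faster than the volume of
  the ball of radius R grows.\<close>

lemma no_positive_subsolution:
  fixes H :: "'a::euclidean_space \<Rightarrow> real" and p q :: real and f :: "real \<Rightarrow> real"
  assumes p: "1 < p" and H: "admissible_anisotropy H"
    and f: "continuous_on {0<..} f" "\<And>v. 0 < v \<Longrightarrow> f v < 0"
    and q: "p - 1 < q" and int: "set_integrable lborel {1..} (\<lambda>v. (- f v) powr (- 1 / q))"
    and dim: "real DIM('a) * (q - p + 1) < p * q"
    and sub: "subsolution p H f u" and u0: "\<And>x. 0 < u x"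
  shows False
proof -
  have u: "continuous_on UNIV u" using sub by (simp add: subsolution_def)
  obtain G0 where W: "W1p_loc p u G0" and weak0: "\<And>\<phi>. \<phi> \<in> test_functions \<Longrightarrow> (\<And>x. 0 \<le> \<phi> x) \<Longrightarrow>
      (LINT x|lebesgue. aniso_field p H (G0 x) \<bullet> grad \<phi> x) \<le> (LINT x|lebesgue. f (u x) * \<phi> x)"
    using sub unfolding subsolution_def by blast
  obtain G where G: "Lp_borel p G" "is_weak_gradient u G" and ae: "AE x in lebesgue. G0 x = G x"
    using W1p_loc_borel_representative[OF W] by blast
  obtain c C where c: "0 < c" "0 < C" "\<And>\<xi>. c * norm \<xi> powr p \<le> aniso_field p H \<xi> \<bullet> \<xi>"
    "\<And>\<xi>. norm (aniso_field p H \<xi>) \<le> C * norm \<xi> powr (p - 1)"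
    using aniso_field_bounds[OF H p] by blast
  have aB: "aniso_field p H \<in> borel_measurable borel" by (rule measurable_aniso_field[OF H p])
  define A where "A x = aniso_field p H (G x)" for x
  have A: "A \<in> borel_measurable borel"
    unfolding A_def[abs_def] by (rule measurable_compose[OF Lp_borel_measurable[OF G(1)] aB])
  have fu: "continuous_on UNIV (\<lambda>x. f (u x))"
    by (rule continuous_on_compose2[OF f(1) u]) (use u0 in auto)
  have ineq: "(LINT x|lborel. A x \<bullet> grad \<phi> x) \<le> (LINT x|lborel. f (u x) * \<phi> x)"
    if \<phi>: "\<phi> \<in> test_functions" "\<And>x. 0 \<le> \<phi> x" for \<phi>
  proof -
    have sm: "smooth \<phi>" using \<phi> by (simp add: test_functions_def smooth_def)
    note [measurable] = A borel_measurable_continuous_onI[OF fu]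
      borel_measurable_continuous_onI[OF smooth_continuous[OF sm]]
      borel_measurable_continuous_onI[OF continuous_on_smooth_grad[OF sm]]
    have m: "(\<lambda>x. A x \<bullet> grad \<phi> x) \<in> borel_measurable lborel" "(\<lambda>x. f (u x) * \<phi> x) \<in> borel_measurable lborel"
      by measurable
    have "G0 \<in> borel_measurable lebesgue" using W by (simp add: W1p_loc_def Lp_loc_def)
    then have m0: "(\<lambda>x. aniso_field p H (G0 x) \<bullet> grad \<phi> x) \<in> borel_measurable lebesgue"
      using borel_measurable_continuous_onI[OF continuous_on_smooth_grad[OF sm]]
      by (intro borel_measurable_inner measurable_compose[OF _ aB]) (auto simp: measurable_completion)
    have "(LINT x|lborel. A x \<bullet> grad \<phi> x) = (LINT x|lebesgue. A x \<bullet> grad \<phi> x)"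
      using m by (simp add: integral_completion)
    also have "\<dots> = (LINT x|lebesgue. aniso_field p H (G0 x) \<bullet> grad \<phi> x)"
      by (rule integral_cong_AE[OF measurable_completion[OF m(1)] m0]) (use ae in \<open>auto simp: A_def\<close>)
    also have "\<dots> \<le> (LINT x|lebesgue. f (u x) * \<phi> x)" by (rule weak0[OF \<phi>])
    also have "\<dots> = (LINT x|lborel. f (u x) * \<phi> x)"
      using m by (simp add: integral_completion)
    finally show ?thesis .
  qed
  define \<kappa> where "\<kappa> t = (- f t) powr (- 1 / q)" for t
  have c\<kappa>: "continuous_on {0<..} \<kappa>"
    unfolding \<kappa>_def[abs_def] by (intro continuous_intros f(1)) (use f(2) in force)
  have \<kappa>0: "0 < \<kappa> t" if "0 < t" for t using f(2)[OF that] by (simp add: \<kappa>_def)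
  obtain \<Phi> where \<Phi>: "\<And>t. 0 < t \<Longrightarrow> 0 < \<Phi> t" "\<And>t. 0 < t \<Longrightarrow> (\<Phi> has_real_derivative - \<kappa> t) (at t)"
    using keller_osserman_primitive[OF c\<kappa> \<kappa>0] int unfolding \<kappa>_def by blast
  define m where "m = (p - 1) * q / (q - p + 1)"
  define e where "e = p * q / (q - p + 1)"
  have "0 < q" using p q by simp
  have "0 < m" "0 < e" using p q \<open>0 < q\<close> by (auto simp: m_def e_def)
  have de: "real DIM('a) < e" using dim q by (simp add: e_def field_simps)
  define \<psi> where "\<psi> t = \<Phi> t powr (- m)" for t
  define \<psi>' where "\<psi>' t = m * \<Phi> t powr (- m - 1) * \<kappa> t" for t
  have d\<psi>: "(\<psi> has_real_derivative \<psi>' t) (at t)" if "0 < t" for t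
    using DERIV_chain2[OF has_real_derivative_powr[OF \<Phi>(1)[OF that], of "- m"] \<Phi>(2)[OF that]]
    unfolding \<psi>_def[abs_def] \<psi>'_def by simp
  have c\<Phi>: "continuous_on {0<..} \<Phi>"
    using \<Phi>(2) by (meson DERIV_isCont continuous_at_imp_continuous_on greaterThan_iff)
  have c\<psi>': "continuous_on {0<..} \<psi>'"
    unfolding \<psi>'_def[abs_def] by (intro continuous_intros c\<Phi> c\<kappa>) (use \<Phi>(1) in force)
  have c\<psi>: "continuous_on {0<..} \<psi>"
    unfolding \<psi>_def[abs_def] by (intro continuous_intros c\<Phi>) (use \<Phi>(1) in force)
  \<comment> \<open>At least \<open>e\<close> for the absorption, and at least 2 for a C^1
    cutoff.\<close>
  define k where "k = nat \<lceil>e\<rceil> + 2"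
  have k: "2 \<le> k" "e \<le> real k" by (auto simp: k_def) linarith
  define T where "T = (c * m) powr ((p - 1) / p) * (1 / 2) powr ((p - 1) / (p * q))"
  have "0 < T" using c(1) \<open>0 < m\<close> by (simp add: T_def)
  \<comment> \<open>\<open>2 * real k\<close> is the constant in the gradient bound of the
    cutoff.\<close>
  define K where "K = C * (2 * real k) / T"
  have "0 < K" using c(2) \<open>0 < T\<close> k by (simp add: K_def)
  define h where "h x = - f (u x) * \<psi> (u x)" for x
  have h0: "0 < h x" for x
  proof -
    have "0 < \<psi> (u x)" using \<Phi>(1)[OF u0, of x] by (simp add: \<psi>_def)
    then show ?thesis using f(2)[OF u0, of x] by (simp add: h_def mult_neg_pos)
  qed
  have ch: "continuous_on UNIV h"
    unfolding h_def[abs_def] by (intro continuous_intros fu continuous_on_compose2[OF c\<psi> u]) (use u0 in auto)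
  define V where "V = unit_ball_vol (real DIM('a))"
  have "0 < V" by (simp add: V_def)
  have ih1: "integrable lborel (\<lambda>x. indicator (cball 0 1) x *\<^sub>R h x)"
    by (rule borel_integrable_compact) (auto intro: continuous_on_subset[OF ch])
  \<comment> \<open>A positive mass independent of \<open>R\<close>; the limit will contradict its
    positivity.\<close>
  define c1 where "c1 = (LINT x|lborel. indicator (cball 0 1) x *\<^sub>R h x)"
  have "0 < c1"
  proof -
    have "cball (0::'a) 1 \<noteq> {}" "continuous_on (cball 0 1) h" using continuous_on_subset[OF ch] by auto
    then obtain y where y: "\<And>x. x \<in> cball 0 1 \<Longrightarrow> h y \<le> h x"
      using continuous_attains_inf[OF compact_cball] by metis
    have "h y * V = (LINT x|lborel. indicator (cball (0::'a) 1) x * h y)"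
      by (simp add: V_def content_cball)
    also have "\<dots> \<le> c1" unfolding c1_def
    proof (rule integral_mono[OF _ ih1])
      have "integrable lborel (\<lambda>x. indicator (cball (0::'a) 1) x *\<^sub>R h y)"
        by (rule borel_integrable_compact) auto
      then show "integrable lborel (\<lambda>x. indicator (cball (0::'a) 1) x * h y)" by simp
    qed (use y in \<open>auto simp: indicator_def\<close>)
    finally show ?thesis using mult_pos_pos[OF h0[of y] \<open>0 < V\<close>] by linarith
  qed
  \<comment> \<open>For \<open>R \<ge> 2\<close> the base \<open>s\<close> of the cutoff is at least
    3/4 on the unit ball, whence the factor on the left.\<close>
  have main: "(3 / 4) ^ k * c1 / 2 \<le> K powr e * V * R powr (real DIM('a) - e)" if "2 \<le> R" for R
  proof -
    have "0 < R" using that by simp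
    define s where "s x = max 0 (1 - x \<bullet> x / R\<^sup>2)" for x :: 'a
    define Z where "Z x = (real k * s x ^ (k - 1) * (- 2 / R\<^sup>2)) *\<^sub>R x" for x
    note cut = cutoff_has_derivative[where 'a='a, OF k(1) \<open>0 < R\<close>, folded s_def, folded Z_def]
    have out: "s x ^ k = 0" "Z x = 0" if "R \<le> norm x" for x
      using cut(3)[OF that] k(1) by (simp_all add: Z_def power_0_left)
    let ?F = "\<lambda>x. A x \<bullet> ((\<psi>' (u x) * s x ^ k) *\<^sub>R G x + \<psi> (u x) *\<^sub>R Z x)"
    have \<psi>0: "0 \<le> \<psi> t" for t by (simp add: \<psi>_def)
    have AC: "norm (A x) \<le> C * norm (G x) powr (p - 1)" for x
      unfolding A_def by (rule c(4))
    have sk: "0 \<le> s x ^ k" for x using cut(4) by simp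
    note test = weak_inequality_composed_test[OF p G(1) A AC c(2) u u0 G(2) fu ineq d\<psi> c\<psi>' \<psi>0
        cut(1,2) sk out \<open>0 < R\<close>]
    define i :: "'a \<Rightarrow> real" where "i = indicator (cball 0 R)"
    define r where "r = (K / R) powr e"
    have ii: "integrable lborel i"
      using borel_integrable_compact[of "cball (0::'a) R" "\<lambda>_. 1::real"] by (simp add: i_def)
    have cs: "continuous_on UNIV s"
      unfolding s_def[abs_def] divide_inverse by (intro continuous_intros)
    have ihs: "integrable lborel (\<lambda>x. h x * s x ^ k)"
      by (rule integrable_continuous_bounded_support[where r=R])
        (auto intro!: continuous_intros ch cs simp: out)
    \<comment> \<open>Coercivity of the field supplies the first Young term and its growth bound the
      cross term. Half of \<open>h x * s x ^ k\<close> is spent here, the other half is kept for the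
      conclusion.\<close>
    have pw: "- (h x * s x ^ k / 2 + r * i x) \<le> ?F x" for x
    proof (cases "norm x \<le> R")
      case True
      have "C * norm (G x) powr (p - 1) * norm (Z x) * \<Phi> (u x) powr (- m)
        \<le> c * norm (G x) powr p * (m * \<Phi> (u x) powr (- m - 1) * (- f (u x)) powr (- 1 / q)) * s x ^ k
          + (- f (u x)) * \<Phi> (u x) powr (- m) * s x ^ k / 2 + r"
        unfolding r_def K_def T_def e_def m_def
        using k(2) by (intro keller_osserman_young p q c(1,2) \<Phi>(1) u0 \<open>0 < R\<close> cut(4,5) k(1) cut(6))
          (use f(2)[OF u0] k(1) in \<open>auto simp: e_def\<close>)
      then have Y: "C * norm (G x) powr (p - 1) * norm (Z x) * \<psi> (u x)
        \<le> c * norm (G x) powr p * \<psi>' (u x) * s x ^ k + h x * s x ^ k / 2 + r"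
        by (simp add: \<psi>_def \<psi>'_def h_def \<kappa>_def)
      have 1: "c * norm (G x) powr p * (\<psi>' (u x) * s x ^ k) \<le> (A x \<bullet> G x) * (\<psi>' (u x) * s x ^ k)"
        unfolding A_def using c(3)[of "G x"] cut(4)[of x] \<kappa>0[OF u0, of x] \<open>0 < m\<close>
        by (intro mult_right_mono) (auto simp: \<psi>'_def)
      have "- (A x \<bullet> Z x) \<le> norm (A x) * norm (Z x)"
        using Cauchy_Schwarz_ineq2[of "A x" "Z x"] by linarith
      also have "\<dots> \<le> C * norm (G x) powr (p - 1) * norm (Z x)"
        unfolding A_def by (intro mult_right_mono c(4)) auto
      finally have "- (A x \<bullet> Z x) * \<psi> (u x) \<le> C * norm (G x) powr (p - 1) * norm (Z x) * \<psi> (u x)"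
        using \<psi>0 by (rule mult_right_mono)
      then have "- (h x * s x ^ k / 2 + r) \<le> (A x \<bullet> G x) * (\<psi>' (u x) * s x ^ k) + (A x \<bullet> Z x) * \<psi> (u x)"
        using 1 Y by (simp add: algebra_simps)
      also have "\<dots> = ?F x" by (simp add: inner_add_right mult.commute)
      finally show ?thesis using True by (simp add: i_def)
    next
      case False
      then show ?thesis using out[of x] k(1) by (simp add: i_def power_0_left)
    qed
    have iV: "(LINT x|lborel. i x) = V * R ^ DIM('a)"
      using \<open>0 < R\<close> by (simp add: i_def V_def content_cball)
    \<comment> \<open>Together with the weak inequality, \<open>pw\<close> bounds the integral of
      \<open>h x * s x ^ k\<close> by half of itself plus the error. This integral is finite because
      the cutoff has bounded support, so the half can be subtracted.\<close>
    have "- ((LINT x|lborel. h x * s x ^ k) / 2 + r * (V * R ^ DIM('a))) = (LINT x|lborel. - (h x * s x ^ k / 2 + r * i x))"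
      using ihs ii by (simp add: iV)
    also have "\<dots> \<le> (LINT x|lborel. ?F x)"
      by (rule integral_mono[OF _ test(1) pw]) (use ihs ii in auto)
    also have "\<dots> \<le> (LINT x|lborel. f (u x) * (\<psi> (u x) * s x ^ k))"
      by (rule test(2))
    also have "\<dots> = - (LINT x|lborel. h x * s x ^ k)"
      by (simp add: h_def mult.assoc)
    finally have le: "(LINT x|lborel. h x * s x ^ k) / 2 \<le> r * (V * R ^ DIM('a))" by linarith
    have "(3 / 4) ^ k * c1 = (LINT x|lborel. (3 / 4) ^ k * (indicator (cball 0 1) x *\<^sub>R h x))"
      unfolding c1_def using ih1 by simp
    also have "\<dots> \<le> (LINT x|lborel. h x * s x ^ k)"
    proof (rule integral_mono[OF integrable_mult_right[OF ih1] ihs])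
      fix x
      show "(3 / 4) ^ k * (indicator (cball 0 1) x *\<^sub>R h x) \<le> h x * s x ^ k"
      proof (cases "x \<in> cball 0 1")
        case True
        have "x \<bullet> x \<le> 1" using True by (simp add: dot_square_norm power_le_one)
        moreover have "4 \<le> R\<^sup>2" using power_mono[OF \<open>2 \<le> R\<close>, of 2] by simp
        ultimately have "x \<bullet> x / R\<^sup>2 \<le> 1 / 4" by (intro frac_le) auto
        then have "3 / 4 \<le> s x" unfolding s_def by linarith
        then have "(3 / 4) ^ k \<le> s x ^ k" by (intro power_mono) auto
        then show ?thesis using True h0[of x] by (simp add: mult.commute mult_left_mono)
      next
        case False
        then show ?thesis using h0[of x] cut(4)[of x] by simp
      qed
    qed
    finally have "(3 / 4) ^ k * c1 / 2 \<le> r * (V * R ^ DIM('a))" using le by linarith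
    also have "\<dots> = K powr e * V * R powr (real DIM('a) - e)"
      using \<open>0 < R\<close> \<open>0 < K\<close> by (simp add: r_def powr_divide powr_diff powr_realpow)
    finally show ?thesis .
  qed
  have "((\<lambda>R. K powr e * V * R powr (real DIM('a) - e)) \<longlongrightarrow> 0) at_top"
    using de by (intro tendsto_mult_right_zero tendsto_neg_powr filterlim_ident) simp
  moreover have "0 < (3 / 4) ^ k * c1 / 2" using \<open>0 < c1\<close> by simp
  ultimately have "\<forall>\<^sub>F R in at_top. K powr e * V * R powr (real DIM('a) - e) < (3 / 4) ^ k * c1 / 2"
    by (rule order_tendstoD(2))
  then have "\<forall>\<^sub>F R::real in at_top. False"
    using eventually_ge_at_top[of 2]
  proof eventually_elim
    case (elim R)
    then show False using main[of R] by linarith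
  qed
  then show False by simp
qed

theorem theorem1p2:
  fixes H :: "real ^ 'n \<Rightarrow> real" and p :: real and f :: "real \<Rightarrow> real"
  assumes "CARD('n) \<ge> 2" and "p > 1"
    and "admissible_anisotropy H"
    and "continuous_on {0<..} f" and "\<forall>v>0. f v < 0"
    and "(p < real CARD('n) \<and>
          (\<exists>q. p - 1 < q \<and>
               q < (real CARD('n) - 1) * p / (real CARD('n) - p) - 1 \<and>
               set_integrable lborel {1..} (\<lambda>v. (- f v) powr (- 1 / q)))) \<or>
         (p \<ge> real CARD('n) \<and>
          (\<exists>q. p - 1 < q \<and>
               set_integrable lborel {1..} (\<lambda>v. (- f v) powr (- 1 / q))))"
  shows "\<not> (\<exists>u. subsolution p H f u \<and> (\<forall>x. 0 < u x))"
proof -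
  define n where "n = real CARD('n)"
  obtain q where q: "p - 1 < q" "set_integrable lborel {1..} (\<lambda>v. (- f v) powr (- 1 / q))"
    and dim: "n * (q - p + 1) < p * q"
    using assms(6)
  proof (elim disjE conjE exE)
    fix q assume pn: "p < real CARD('n)" and "p - 1 < q"
      and up: "q < (real CARD('n) - 1) * p / (real CARD('n) - p) - 1"
      and i: "set_integrable lborel {1..} (\<lambda>v. (- f v) powr (- 1 / q))"
    \<comment> \<open>Clear the positive denominator \<open>n - p\<close>; expanding both sides then
      gives \<open>dim\<close>.\<close>
    have "(q + 1) * (n - p) < (n - 1) * p"
      using pn up by (simp add: n_def pos_less_divide_eq less_diff_eq)
    then show thesis using that[OF \<open>p - 1 < q\<close> i] by (simp add: algebra_simps)
  next
    fix q assume pn: "p \<ge> real CARD('n)" and "p - 1 < q"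
      and i: "set_integrable lborel {1..} (\<lambda>v. (- f v) powr (- 1 / q))"
    \<comment> \<open>Here \<open>n\<close> may be enlarged to \<open>p\<close>, and
      \<open>q - p + 1 < q\<close> because \<open>p > 1\<close>.\<close>
    have "n * (q - p + 1) \<le> p * (q - p + 1)"
      using pn \<open>p - 1 < q\<close> by (intro mult_right_mono) (auto simp: n_def)
    also have "\<dots> < p * q" using assms(2) by (intro mult_strict_left_mono) auto
    finally show thesis using that[OF \<open>p - 1 < q\<close> i] by blast
  qed
  then show ?thesis
    using no_positive_subsolution[OF assms(2,3,4) _ q] assms(5) by (auto simp: n_def)
qed

end
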